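(* Let $\eta_t$ and $\bar\eta_t$ be exclusion processes with rates $p$ and $\bar p$, respectively, both satisfying the standing assumptions on rates. Suppose that whenever $\eta\prec\bar\eta$ (with $\eta,\bar\eta\in\mathcal{X}$) and $x,y,\bar x,\bar y\in\mathbb{Z}$ satisfy $\eta(x)=\bar\eta(\bar x)=1$ and $\eta(y)=\bar\eta(\bar y)=0$, one has $$p(x,y;\eta)\ge\bar p(\bar x,\bar y;\bar\eta)\quad\text{if } \bar x\le x<y\le\bar y,$$ $$p(x,y;\eta)\le\bar p(\bar x,\bar y;\bar\eta)\quad\text{if } y\le\bar y<\bar x\le x.$$ Then if $\bar\eta_t$ restricted to $\mathcal{X}$ has a blocking invariant measure, so does $\eta_t$.
   Context: Exclusion process. For $\eta\in\{0,1\}^{\mathbb{Z}}$ and $x,y\in\mathbb{Z}$, $\eta^{x,y}$ is the configuration obtained from $\eta$ by exchanging the values at $x$ and $y$. Rates are functions $p(x,y;\eta)\ge 0$, continuous in $\eta$ (product topology), with $p(x,y;\eta)=0$ unless $\eta(x)=1$ and $\eta(y)=0$. The exclusion process with rates $p$ has generator $Lf(\eta)=\sum_{x\in\mathbb{Z}}\sum_{y\in\mathbb{Z}}p(x,y;\eta)[f(\eta^{x,y})-f(\eta)]$. Blocking configurations. For $n\in\mathbb{Z}$ let $\mathcal{X}_n=\{\eta\in\{0,1\}^{\mathbb{Z}}:\sum_{x\le n}\eta(x)=\sum_{x>n}(1-\eta(x))<\infty\}$ and $\mathcal{X}=\bigcup_n\mathcal{X}_n$, a countable set whose elements are called blocking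 configurations. A blocking measure is a probability measure supported on $\mathcal{X}$. Standing assumptions on all rates $p$ (and likewise $\bar p$): (i) $0\le p(x,y;\eta)\le 1$; (ii) for every $\zeta\in\mathcal{X}$, $\sum_x\sum_y p(x,y;\zeta)<\infty$. On $\mathcal{X}$ the process is the continuous time Markov jump chain that jumps from $\eta$ to $\eta^{x,y}$ at rate $p(x,y;\eta)$ (constructed jump by jump, i.e. the minimal chain, with explosions not excluded a priori). A blocking invariant measure for the process is a blocking measure $\mu$ such that if $\eta_0$ has law $\mu$ then $\eta_t$ has law $\mu$ for every $t\ge0$ (in particular the process started from $\mu$ almost surely does not explode). Order. For $\eta\in\mathcal{X}$ let $x_0(\eta)<x_1(\eta)<\cdots$ be the positions of the particles (sites with $\eta(x)=1$) listed in increasing order, and $y_0(\eta)>y_1(\eta)>\cdots$ the positions of the holes (sites with $\eta(x)=0$) listed in decreasing order. For $\eta,\bar\eta\in\mathcal{X}$, $\eta\prec\bar\eta$ means that $x_i(\eta)\ge x_i(\bar\eta)$ and $y_j(\eta)\le y_j(\bar\eta)$ for all $i,j\ge0$. *)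

theory Defs
  imports "HOL-Probability.Probability"
begin

text \<open>A configuration in \<open>{0,1}\<^sup>\<int>\<close> is a predicate on the integers; \<open>\<eta> x\<close> means that
  site \<open>x\<close> is occupied. The topology on this type is the product of discrete topologies.\<close>

type_synonym config = "int \<Rightarrow> bool"

type_synonym rates = "int \<Rightarrow> int \<Rightarrow> config \<Rightarrow> real"

definition exchange :: "config \<Rightarrow> int \<Rightarrow> int \<Rightarrow> config" where
  "exchange \<eta> x y = \<eta>(x := \<eta> y, y := \<eta> x)"

text \<open>The finiteness conjuncts are needed because \<open>card\<close> is \<open>0\<close> on infinite sets.\<close>

definition blocking_configs_at :: "int \<Rightarrow> config set" where
  "blocking_configs_at n =
     {\<eta>. finite {x. x \<le> n \<and> \<eta> x} \<and> finite {x. x > n \<and> \<not> \<eta> x} \<and>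
         card {x. x \<le> n \<and> \<eta> x} = card {x. x > n \<and> \<not> \<eta> x}}"

definition blocking_configs :: "config set" where
  "blocking_configs = (\<Union>n. blocking_configs_at n)"

definition exclusion_rates :: "rates \<Rightarrow> bool" where
  "exclusion_rates p \<longleftrightarrow>
     (\<forall>x y. continuous_on UNIV (p x y)) \<and>
     (\<forall>x y \<eta>. \<not> (\<eta> x \<and> \<not> \<eta> y) \<longrightarrow> p x y \<eta> = 0) \<and>
     (\<forall>x y \<eta>. 0 \<le> p x y \<eta> \<and> p x y \<eta> \<le> 1) \<and>
     (\<forall>\<zeta>\<in>blocking_configs. (\<lambda>(x, y). p x y \<zeta>) summable_on UNIV)"

text \<open>For blocking configurations the enumerations below exist and are unique.\<close>

definition particle_pos :: "config \<Rightarrow> nat \<Rightarrow> int" where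
  "particle_pos \<eta> = (THE f. strict_mono f \<and> range f = {x. \<eta> x})"

definition hole_pos :: "config \<Rightarrow> nat \<Rightarrow> int" where
  "hole_pos \<eta> = (THE f. (\<forall>i j. i < j \<longrightarrow> f i > f j) \<and> range f = {x. \<not> \<eta> x})"

definition config_prec :: "config \<Rightarrow> config \<Rightarrow> bool" (infix "\<prec>" 50) where
  "\<eta> \<prec> \<eta>' \<longleftrightarrow> \<eta> \<in> blocking_configs \<and> \<eta>' \<in> blocking_configs \<and>
     (\<forall>i. particle_pos \<eta> i \<ge> particle_pos \<eta>' i) \<and> (\<forall>j. hole_pos \<eta> j \<le> hole_pos \<eta>' j)"

text \<open>The Markov jump chain is constructed jump by jump: from \<open>\<eta>\<close> it waits an exponential time
  with parameter \<open>total_rate p \<eta>\<close> (forever if this is \<open>0\<close>) and then moves to \<open>exchange \<eta> x y\<close>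
  with probability \<open>p x y \<eta> / total_rate p \<eta>\<close>. Thus the first jump happens in \<open>ds\<close> and uses the
  pair \<open>(x, y)\<close> with probability \<open>p x y \<eta> * exp (- total_rate p \<eta> * s) ds\<close>.
  \<open>trans_upto p n t \<eta> \<zeta>\<close> is the probability that the chain started in \<open>\<eta>\<close> makes at most \<open>n\<close> jumps
  up to time \<open>t\<close> and is in \<open>\<zeta>\<close> at time \<open>t\<close>, computed by conditioning on the first jump.
  Letting \<open>n\<close> grow gives the transition function of the minimal chain: \<open>trans_prob p t \<eta> \<zeta>\<close> is
  the probability of having made finitely many jumps up to time \<open>t\<close> and being in \<open>\<zeta>\<close> at time
  \<open>t\<close>, and \<open>1\<close> minus its sum over \<open>\<zeta>\<close> is the probability of explosion by time \<open>t\<close>.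
  This is meaningful for \<open>\<eta>\<close> in \<open>blocking_configs\<close>, where the rates are summable; this set is
  preserved by the jumps.\<close>

definition total_rate :: "rates \<Rightarrow> config \<Rightarrow> real" where
  "total_rate p \<eta> = (\<Sum>\<^sub>\<infinity>(x, y)\<in>UNIV. p x y \<eta>)"

primrec trans_upto :: "rates \<Rightarrow> nat \<Rightarrow> real \<Rightarrow> config \<Rightarrow> config \<Rightarrow> ennreal" where
  "trans_upto p 0 t \<eta> \<zeta> = (if \<eta> = \<zeta> then ennreal (exp (- total_rate p \<eta> * t)) else 0)"
| "trans_upto p (Suc n) t \<eta> \<zeta> =
     (if \<eta> = \<zeta> then ennreal (exp (- total_rate p \<eta> * t)) else 0) +
     (\<integral>\<^sup>+ s\<in>{0..t}. ennreal (exp (- total_rate p \<eta> * s)) *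
        (\<integral>\<^sup>+ xy. ennreal (p (fst xy) (snd xy) \<eta>) *
            trans_upto p n (t - s) (exchange \<eta> (fst xy) (snd xy)) \<zeta> \<partial>count_space UNIV)
      \<partial>lborel)"

definition trans_prob :: "rates \<Rightarrow> real \<Rightarrow> config \<Rightarrow> config \<Rightarrow> ennreal" where
  "trans_prob p t \<eta> \<zeta> = (SUP n. trans_upto p n t \<eta> \<zeta>)"

text \<open>As \<open>blocking_configs\<close> is countable, probability measures on it are discrete. The integral is
  the probability that \<open>\<eta>\<^sub>t = \<zeta>\<close> (without prior explosion) when \<open>\<eta>\<^sub>0\<close> has law \<open>\<mu>\<close>; summing the
  condition over \<open>\<zeta>\<close> shows that invariance excludes explosion.\<close>

definition blocking_measure :: "config pmf \<Rightarrow> bool" where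
  "blocking_measure \<mu> \<longleftrightarrow> set_pmf \<mu> \<subseteq> blocking_configs"

definition blocking_invariant_measure :: "rates \<Rightarrow> config pmf \<Rightarrow> bool" where
  "blocking_invariant_measure p \<mu> \<longleftrightarrow> blocking_measure \<mu> \<and>
     (\<forall>t\<ge>0. \<forall>\<zeta>. (\<integral>\<^sup>+ \<eta>. trans_prob p t \<eta> \<zeta> \<partial>measure_pmf \<mu>) = ennreal (pmf \<mu> \<zeta>))"

end

theory Submission
  imports Defs "HOL-Real_Asymp.Real_Asymp" "HOL-Library.Diagonal_Subsequence"
begin

text \<open>
  The heuristic reason is a coupling: started from the same blocking configuration, the two
  processes can be run together so that \<open>\<eta>\<^sub>t \<prec> \<eta>'\<^sub>t\<close> for all times. As only finitely many
  configurations lie below a given one, \<open>\<eta>\<^sub>t\<close> inherits tightness (and non-explosion) from the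
  stationary process \<open>\<eta>'\<^sub>t\<close>, and a limit of time averages of its law is invariant.

  The coupling lets the \<open>i\<close>-th particle attempt to jump to the \<open>j\<close>-th hole in both processes at
  once. If these jumps have the same direction in both configurations, one of the two rates is
  the larger one by hypothesis and the excess is performed by one process alone; if the directions
  differ, the two processes jump independently. Encoding a configuration by its counting functions
  of particles to the left and of holes to the right turns \<open>\<prec>\<close> into a pointwise inequality, in
  which one sees that each of these moves preserves the order (\<open>exchange_both_prec\<close>,
  \<open>exchange_lower_prec\<close>, \<open>prec_exchange_upper\<close>).

  No coupled process is constructed below. Taking Laplace transforms in time, the minimal
  transition semigroup becomes the resolvent, the minimal solution \<open>r\<close> of
  \<open>(\<alpha> + q) r = f + (jump operator applied to r)\<close>, where \<open>q\<close> is the total rate. For decreasing \<open>f\<close> the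
  inequality \<open>r'(\<eta>') \<le> r(\<eta>)\<close> for \<open>\<eta> \<prec> \<eta>'\<close> is a maximum principle: \<open>r'\<close> is the limit of its
  approximations by finitely many jumps, and for fixed \<open>\<eta>'\<close> the value \<open>r(\<eta>)\<close> attains its minimum
  over the finite set of \<open>\<eta> \<prec> \<eta>'\<close>. At a minimum the two equations, compared term by term along the
  coupling, give the inequality (\<open>resolvent_upto_dominated\<close>).

  Let \<open>\<mu>\<close> be the invariant measure for the rates \<open>pbar\<close> and let \<open>m\<^sub>\<alpha>\<close> be \<open>\<alpha>\<close> times the resolvent of
  the rates \<open>p\<close> started from \<open>\<mu>\<close>, that is, the law of the process at an independent exponential
  time with parameter \<open>\<alpha>\<close>. The comparison gives \<open>m\<^sub>\<alpha>(D) \<ge> \<mu>(D)\<close> for every set \<open>D\<close> closed downwards in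
  \<open>\<prec>\<close>, so the \<open>m\<^sub>\<alpha>\<close> are probability measures and they are tight. Moreover \<open>m\<^sub>\<alpha> P\<^sub>h \<le> exp(\<alpha> h) m\<^sub>\<alpha>\<close>, and no
  mass is lost under \<open>P\<^sub>h\<close>. A pointwise limit along a sequence \<open>\<alpha> \<rightarrow> 0\<close> is therefore a probability
  measure \<open>l\<close> with \<open>l P\<^sub>h \<le> l\<close> and equal total masses, hence \<open>l P\<^sub>h = l\<close>.
\<close>

(* The symbol is shared with the comparison of cardinalities; only the order on configurations
   is meant below. *)
no_notation lesspoll (infixl "\<prec>" 50)

notation blocking_configs ("\<X>")

section \<open>Blocking configurations and the order\<close>

definition particles_upto :: "config \<Rightarrow> int \<Rightarrow> nat" where
  "particles_upto \<eta> z = card {x. x \<le> z \<and> \<eta> x}"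

definition holes_above :: "config \<Rightarrow> int \<Rightarrow> nat" where
  "holes_above \<eta> z = card {y. y > z \<and> \<not> \<eta> y}"

lemma finite_particles_upto_shift:
  assumes "finite {x. x \<le> a \<and> \<eta> x}"
  shows "finite {x::int. x \<le> z \<and> \<eta> x}"
  by (rule finite_subset[of _ "{x. x \<le> a \<and> \<eta> x} \<union> {a..z}"]) (use assms in auto)

lemma finite_holes_above_shift:
  assumes "finite {y. y > a \<and> \<not> \<eta> y}"
  shows "finite {y::int. y > z \<and> \<not> \<eta> y}"
  by (rule finite_subset[of _ "{y. y > a \<and> \<not> \<eta> y} \<union> {z..a}"]) (use assms in auto)

lemma particles_upto_step:
  assumes "finite {x. x \<le> z \<and> \<eta> x}"
  shows "particles_upto \<eta> (z + 1) = particles_upto \<eta> z + (if \<eta> (z + 1) then 1 else 0)"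
proof -
  have le: "x \<le> z + 1 \<longleftrightarrow> x = z + 1 \<or> x \<le> z" for x by linarith
  have "{x. x \<le> z + 1 \<and> \<eta> x} =
      (if \<eta> (z + 1) then insert (z + 1) {x. x \<le> z \<and> \<eta> x} else {x. x \<le> z \<and> \<eta> x})"
    by (auto simp: le)
  then show ?thesis using assms by (auto simp: particles_upto_def)
qed

lemma holes_above_step:
  assumes "finite {y. y > z \<and> \<not> \<eta> y}"
  shows "holes_above \<eta> z = holes_above \<eta> (z + 1) + (if \<eta> (z + 1) then 0 else 1)"
proof -
  have eq: "{y. y > z \<and> \<not> \<eta> y} =
      (if \<eta> (z + 1) then {y. y > z + 1 \<and> \<not> \<eta> y} else insert (z + 1) {y. y > z + 1 \<and> \<not> \<eta> y})"
    by auto (metis add1_zle_eq order_le_imp_less_or_eq)+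
  have "finite {y. y > z + 1 \<and> \<not> \<eta> y}"
    using finite_holes_above_shift[OF assms] .
  then show ?thesis by (simp add: holes_above_def eq)
qed

text \<open>Moving one site to the right either gains a particle or loses a hole, so the difference of the two
counts grows by exactly one per site.\<close>

lemma particles_minus_holes:
  assumes "finite {x. x \<le> a \<and> \<eta> x}" "finite {y. y > a \<and> \<not> \<eta> y}"
  shows "int (particles_upto \<eta> z) - int (holes_above \<eta> z) =
    int (particles_upto \<eta> a) - int (holes_above \<eta> a) + (z - a)"
proof -
  have fin: "finite {x. x \<le> w \<and> \<eta> x}" "finite {y. y > w \<and> \<not> \<eta> y}" for w
    using assms finite_particles_upto_shift finite_holes_above_shift by blast+
  have step: "int (particles_upto \<eta> (w + 1)) - int (holes_above \<eta> (w + 1)) =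
      int (particles_upto \<eta> w) - int (holes_above \<eta> w) + 1" for w
    using particles_upto_step[OF fin(1), of w] holes_above_step[OF fin(2), of w] by auto
  show ?thesis
  proof (induction z rule: int_induct[where k = a])
    case (step2 i)
    then show ?case using step[of "i - 1"] by simp
  qed (use step in auto)
qed

text \<open>The balance condition picks out the index \<open>n\<close> of the class, and by \<open>particles_minus_holes\<close>
every configuration with both counts finite is balanced at exactly one site.\<close>

lemma blocking_configs_iff:
  "\<eta> \<in> \<X> \<longleftrightarrow>
    finite {x. x \<le> 0 \<and> \<eta> x} \<and> finite {y. y > 0 \<and> \<not> \<eta> y}" (is "?L \<longleftrightarrow> ?R")
proof
  assume ?L
  then show ?R
    using finite_particles_upto_shift finite_holes_above_shift
    by (auto simp: blocking_configs_def blocking_configs_at_def)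
next
  assume R: ?R
  define n where "n = int (holes_above \<eta> 0) - int (particles_upto \<eta> 0)"
  have "int (particles_upto \<eta> n) = int (holes_above \<eta> n)"
    using particles_minus_holes[of 0 \<eta> n] R by (simp add: n_def)
  then have "\<eta> \<in> blocking_configs_at n"
    using R finite_particles_upto_shift finite_holes_above_shift
    by (auto simp: blocking_configs_at_def particles_upto_def holes_above_def)
  then show ?L by (auto simp: blocking_configs_def)
qed

lemma blocking_finite:
  assumes "\<eta> \<in> \<X>"
  shows "finite {x. x \<le> z \<and> \<eta> x}" "finite {y. y > z \<and> \<not> \<eta> y}"
  using assms finite_particles_upto_shift finite_holes_above_shift
  by (auto simp: blocking_configs_iff)

lemma exchange_blocking:
  assumes "\<eta> \<in> \<X>"
  shows "exchange \<eta> x y \<in> \<X>"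
proof -
  have "finite {u. u \<le> 0 \<and> exchange \<eta> x y u}"
    by (rule finite_subset[of _ "{u. u \<le> 0 \<and> \<eta> u} \<union> {x, y}"])
      (use blocking_finite[OF assms] in \<open>auto simp: exchange_def split: if_splits\<close>)
  moreover have "finite {u. u > 0 \<and> \<not> exchange \<eta> x y u}"
    by (rule finite_subset[of _ "{u. u > 0 \<and> \<not> \<eta> u} \<union> {x, y}"])
      (use blocking_finite[OF assms] in \<open>auto simp: exchange_def split: if_splits\<close>)
  ultimately show ?thesis by (simp add: blocking_configs_iff)
qed

text \<open>A blocking configuration differs from the step at the origin in a finite set of sites.\<close>

lemma countable_blocking_configs: "countable \<X>"
proof -
  let ?F = "\<lambda>\<eta>::config. ({x. x \<le> 0 \<and> \<eta> x}, {y. y > 0 \<and> \<not> \<eta> y})"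
  have "inj_on ?F \<X>"
    by (rule inj_onI, rule ext) (simp add: set_eq_iff, metis not_le)
  moreover have "?F ` \<X> \<subseteq> Collect finite \<times> Collect finite"
    by (auto simp: blocking_configs_iff)
  ultimately show ?thesis
    by (meson countable_Collect_finite countable_SIGMA countable_image_inj_on countable_subset)
qed

text \<open>Counting the particles below \<open>f i\<close> recovers \<open>i\<close>, so an increasing enumeration is unique.\<close>

lemma strict_mono_range_unique:
  fixes f g :: "nat \<Rightarrow> int"
  assumes f: "strict_mono f" and g: "strict_mono g" and eq: "range f = range g"
  shows "f = g"
proof
  have cnt: "card {x \<in> range h. x < h i} = i" if "strict_mono h" for h :: "nat \<Rightarrow> int" and i
  proof -
    have "{x \<in> range h. x < h i} = h ` {..<i}"
      using that by (auto simp: strict_mono_less)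
    then show ?thesis
      using that by (simp add: card_image strict_mono_imp_inj_on inj_on_subset)
  qed
  fix i
  obtain k where k: "f i = g k" using eq by (metis rangeE rangeI)
  have "i = k" using cnt[OF f, of i] cnt[OF g, of k] k eq by simp
  then show "f i = g i" using k by simp
qed

lemma ex_increasing_enumeration:
  assumes fin: "finite {x::int. x \<le> 0 \<and> P x}" and inf: "finite {x. x > 0 \<and> \<not> P x}"
  shows "\<exists>f::nat \<Rightarrow> int. strict_mono f \<and> range f = {x. P x}"
proof -
  obtain b where b: "\<And>x. x \<le> 0 \<Longrightarrow> P x \<Longrightarrow> b \<le> x" "b \<le> 0"
  proof (cases "{x::int. x \<le> 0 \<and> P x} = {}")
    case True then show ?thesis using that[of 0] by auto
  next
    case False
    show ?thesis
      using that[of "Min {x::int. x \<le> 0 \<and> P x}"] fin False Min_le[OF fin] Min_in[OF fin False]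
      by auto
  qed
  \<comment> \<open>translated to start at \<open>0\<close>, so that the enumeration of infinite sets of naturals applies\<close>
  define S where "S = {k::nat. P (b + int k)}"
  have "infinite S"
  proof
    assume S: "finite S"
    have "{k::nat. b + int k > 0} \<subseteq> S \<union> (\<lambda>x. nat (x - b)) ` {x. x > 0 \<and> \<not> P x}"
      by (force simp: S_def image_iff)
    then have "finite {k::nat. b + int k > 0}"
      using S inf by (meson finite_UnI finite_imageI finite_subset)
    moreover have "{nat (1 - b)..} \<subseteq> {k::nat. b + int k > 0}" by auto
    ultimately show False by (meson finite_subset infinite_Ici)
  qed
  let ?f = "\<lambda>i. b + int (enumerate S i)"
  have "strict_mono ?f"
    using strict_mono_enumerate[OF \<open>infinite S\<close>] by (auto simp: strict_mono_def)
  moreover have "range ?f = {x. P x}"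
  proof -
    have "range ?f = (\<lambda>k. b + int k) ` range (enumerate S)"
      by (simp only: image_image)
    also have "\<dots> = (\<lambda>k. b + int k) ` S"
      by (simp only: range_enumerate[OF \<open>infinite S\<close>])
    also have "\<dots> = {x. P x}"
    proof -
      have "x \<in> (\<lambda>k. b + int k) ` S" if "P x" for x
      proof -
        have "b \<le> x" using b that by (cases "x \<le> 0") auto
        then have "x = b + int (nat (x - b))" by simp
        then show ?thesis using that unfolding S_def by (metis (mono_tags) image_eqI mem_Collect_eq)
      qed
      then show ?thesis by (auto simp: S_def)
    qed
    finally show ?thesis .
  qed
  ultimately show ?thesis by blast
qed

lemma particle_pos:
  assumes "\<eta> \<in> \<X>"
  shows "strict_mono (particle_pos \<eta>)" "range (particle_pos \<eta>) = {x. \<eta> x}"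
proof -
  have "\<exists>!f::nat \<Rightarrow> int. strict_mono f \<and> range f = {x. \<eta> x}"
    using ex_increasing_enumeration[of \<eta>] blocking_finite[OF assms, of 0] strict_mono_range_unique
    by metis
  from theI'[OF this] show "strict_mono (particle_pos \<eta>)" "range (particle_pos \<eta>) = {x. \<eta> x}"
    by (auto simp: particle_pos_def)
qed

text \<open>Reflecting \<open>\<int>\<close> turns holes listed in decreasing order into particles listed in increasing
  order.\<close>

lemma hole_pos:
  assumes "\<eta> \<in> \<X>"
  shows "strict_mono (\<lambda>j. - hole_pos \<eta> j)" "range (hole_pos \<eta>) = {y. \<not> \<eta> y}"
proof -
  let ?Q = "\<lambda>f::nat \<Rightarrow> int. (\<forall>i j. i < j \<longrightarrow> f i > f j) \<and> range f = {y. \<not> \<eta> y}"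
  have Q: "?Q f \<longleftrightarrow> strict_mono (\<lambda>j. - f j) \<and> range (\<lambda>j. - f j) = {x. \<not> \<eta> (- x)}" for f
  proof -
    have "range (\<lambda>j. - f j) = uminus ` range f" by auto
    moreover have "{x. \<not> \<eta> (- x)} = uminus ` {y. \<not> \<eta> y}"
      by (auto simp: image_iff) (metis minus_minus)
    ultimately show ?thesis
      by (auto simp: strict_mono_def inj_image_eq_iff)
  qed
  have 1: "finite {x. x \<le> 0 \<and> \<not> \<eta> (- x)}"
    using finite_imageI[OF blocking_finite(2)[OF assms, of "-1"], of uminus]
    by (rule finite_subset[rotated]) (force simp: image_iff)
  have 2: "finite {x. x > 0 \<and> \<not> \<not> \<eta> (- x)}"
    using finite_imageI[OF blocking_finite(1)[OF assms, of 0], of uminus]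
    by (rule finite_subset[rotated]) (force simp: image_iff)
  obtain g :: "nat \<Rightarrow> int" where "strict_mono g" "range g = {x. \<not> \<eta> (- x)}"
    using ex_increasing_enumeration[OF 1 2] by auto
  then have "?Q (\<lambda>j. - g j)" using Q[of "\<lambda>j. - g j"] by simp
  moreover have "f = f'" if "?Q f" "?Q f'" for f f'
  proof -
    have "(\<lambda>j. - f j) = (\<lambda>j. - f' j)"
      using that strict_mono_range_unique[of "\<lambda>j. - f j" "\<lambda>j. - f' j"] unfolding Q by simp
    then show ?thesis by (simp add: fun_eq_iff)
  qed
  ultimately have "\<exists>!f. ?Q f" by (intro ex1I[of ?Q]) (assumption | simp only:)+
  from theI'[OF this] have "?Q (hole_pos \<eta>)" unfolding hole_pos_def .
  then show "strict_mono (\<lambda>j. - hole_pos \<eta> j)" "range (hole_pos \<eta>) = {y. \<not> \<eta> y}"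
    by (auto simp: strict_mono_def)
qed

lemma less_card_iff_enumeration_le:
  fixes f :: "nat \<Rightarrow> int"
  assumes f: "strict_mono f" and fin: "finite {x \<in> range f. x \<le> z}"
  shows "i < card {x \<in> range f. x \<le> z} \<longleftrightarrow> f i \<le> z"
proof
  have inj: "inj_on f A" for A using f by (meson inj_on_subset strict_mono_imp_inj_on top_greatest)
  show "i < card {x \<in> range f. x \<le> z}" if "f i \<le> z"
  proof -
    have "f ` {..i} \<subseteq> {x \<in> range f. x \<le> z}"
      using that f by (auto simp: strict_mono_less_eq dest: order_trans[of "f _" "f i" z, rotated])
    from card_mono[OF fin this] show ?thesis by (simp add: card_image inj)
  qed
  show "f i \<le> z" if "i < card {x \<in> range f. x \<le> z}"
  proof (rule ccontr)
    assume "\<not> f i \<le> z"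
    then have "{x \<in> range f. x \<le> z} \<subseteq> f ` {..<i}"
      using strict_mono_less[OF f] by (force simp: image_iff)
    from card_mono[OF _ this] have "card {x \<in> range f. x \<le> z} \<le> i" by (simp add: card_image inj)
    with that show False by simp
  qed
qed

lemma less_particles_upto_iff:
  assumes "\<eta> \<in> \<X>"
  shows "i < particles_upto \<eta> z \<longleftrightarrow> particle_pos \<eta> i \<le> z"
proof -
  have eq: "{x \<in> range (particle_pos \<eta>). x \<le> z} = {x. x \<le> z \<and> \<eta> x}"
    using particle_pos(2)[OF assms] by auto
  show ?thesis
    using less_card_iff_enumeration_le[OF particle_pos(1)[OF assms], of z i] blocking_finite(1)[OF assms, of z]
    unfolding eq particles_upto_def by blast
qed

lemma less_holes_above_iff:
  assumes "\<eta> \<in> \<X>"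
  shows "j < holes_above \<eta> z \<longleftrightarrow> z < hole_pos \<eta> j"
proof -
  let ?A = "{x \<in> range (\<lambda>j. - hole_pos \<eta> j). x \<le> - z - 1}"
  have "range (\<lambda>j. - hole_pos \<eta> j) = uminus ` range (hole_pos \<eta>)" by auto
  then have "?A = {x \<in> uminus ` {y. \<not> \<eta> y}. x \<le> - z - 1}"
    using hole_pos(2)[OF assms] by simp
  also have "\<dots> = uminus ` {y. y > z \<and> \<not> \<eta> y}" by auto
  finally have A: "?A = uminus ` {y. y > z \<and> \<not> \<eta> y}" .
  then have "card ?A = holes_above \<eta> z" by (simp add: card_image holes_above_def)
  moreover have "finite ?A" using A blocking_finite(2)[OF assms, of z] by simp
  ultimately show ?thesis
    using less_card_iff_enumeration_le[OF hole_pos(1)[OF assms], of "- z - 1" j] by auto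
qed

text \<open>The \<open>i\<close>-th particle, counted from \<open>0\<close>, has position at most \<open>z\<close> iff more than \<open>i\<close> particles do, so
comparing the positions of all particles is comparing the counting functions. The rest of the
development argues with the counts, which change simply under exchanges.\<close>

lemma config_prec_iff:
  "\<eta> \<prec> \<eta>' \<longleftrightarrow> \<eta> \<in> \<X> \<and> \<eta>' \<in> \<X> \<and>
     (\<forall>z. particles_upto \<eta> z \<le> particles_upto \<eta>' z \<and> holes_above \<eta> z \<le> holes_above \<eta>' z)"
proof (cases "\<eta> \<in> \<X> \<and> \<eta>' \<in> \<X>")
  case True
  have le: "(m::nat) \<le> n \<longleftrightarrow> (\<forall>i. i < m \<longrightarrow> i < n)" for m n
    by (meson leI less_irrefl less_le_trans)
  have "(\<forall>z. particles_upto \<eta> z \<le> particles_upto \<eta>' z) \<longleftrightarrow>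
      (\<forall>i z. particle_pos \<eta> i \<le> z \<longrightarrow> particle_pos \<eta>' i \<le> z)"
    using True by (simp only: le less_particles_upto_iff) blast
  also have "\<dots> \<longleftrightarrow> (\<forall>i. particle_pos \<eta> i \<ge> particle_pos \<eta>' i)"
    by (meson order_refl order_trans)
  finally have 1: "(\<forall>z. particles_upto \<eta> z \<le> particles_upto \<eta>' z) \<longleftrightarrow>
      (\<forall>i. particle_pos \<eta> i \<ge> particle_pos \<eta>' i)" .
  have "(\<forall>z. holes_above \<eta> z \<le> holes_above \<eta>' z) \<longleftrightarrow>
      (\<forall>j z. z < hole_pos \<eta> j \<longrightarrow> z < hole_pos \<eta>' j)"
    using True by (simp only: le less_holes_above_iff) blast
  also have "\<dots> \<longleftrightarrow> (\<forall>j. hole_pos \<eta> j \<le> hole_pos \<eta>' j)"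
    by (meson leI less_irrefl less_le_trans)
  finally have 2: "(\<forall>z. holes_above \<eta> z \<le> holes_above \<eta>' z) \<longleftrightarrow>
      (\<forall>j. hole_pos \<eta> j \<le> hole_pos \<eta>' j)" .
  show ?thesis using True 1 2 by (simp only: config_prec_def all_conj_distrib)
qed (auto simp: config_prec_def)

lemma config_prec_refl: "\<eta> \<in> \<X> \<Longrightarrow> \<eta> \<prec> \<eta>"
  by (simp add: config_prec_def)

lemma config_prec_trans:
  assumes "\<eta> \<prec> \<eta>'" "\<eta>' \<prec> \<eta>''"
  shows "\<eta> \<prec> \<eta>''"
proof -
  have "particle_pos \<eta>'' i \<le> particle_pos \<eta> i" "hole_pos \<eta> i \<le> hole_pos \<eta>'' i" for i
    using assms order_trans[of "particle_pos \<eta>'' i" "particle_pos \<eta>' i"]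
      order_trans[of "hole_pos \<eta> i" "hole_pos \<eta>' i"]
    by (auto simp: config_prec_def)
  then show ?thesis using assms by (simp add: config_prec_def)
qed

lemma particles_upto_eq_0_iff:
  assumes "\<eta> \<in> \<X>"
  shows "particles_upto \<eta> z = 0 \<longleftrightarrow> (\<forall>x\<le>z. \<not> \<eta> x)"
  using blocking_finite(1)[OF assms, of z] by (auto simp: particles_upto_def)

lemma holes_above_eq_0_iff:
  assumes "\<eta> \<in> \<X>"
  shows "holes_above \<eta> z = 0 \<longleftrightarrow> (\<forall>y>z. \<eta> y)"
  using blocking_finite(2)[OF assms, of z] by (auto simp: holes_above_def)

lemma ex_particles_upto_eq_0:
  assumes "\<eta> \<in> \<X>"
  shows "\<exists>a. particles_upto \<eta> a = 0"
  using less_particles_upto_iff[OF assms, of 0 "particle_pos \<eta> 0 - 1"] by auto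

lemma ex_holes_above_eq_0:
  assumes "\<eta> \<in> \<X>"
  shows "\<exists>b. holes_above \<eta> b = 0"
  using less_holes_above_iff[OF assms, of 0 "hole_pos \<eta> 0"] by auto

text \<open>This finiteness is what makes domination useful: to the left of the first particle of \<open>\<eta>'\<close> and to
the right of its last hole, everything below \<open>\<eta>'\<close> agrees with a step, which leaves finitely many
undetermined sites.\<close>

lemma finite_config_prec_below: "finite {\<eta>. \<eta> \<prec> \<eta>'}"
proof (cases "\<eta>' \<in> \<X>")
  case True
  obtain a b where ab: "particles_upto \<eta>' a = 0" "holes_above \<eta>' b = 0"
    using ex_particles_upto_eq_0[OF True] ex_holes_above_eq_0[OF True] by blast
  have fixed: "\<not> \<eta> x" if "x \<le> a" "\<eta> \<prec> \<eta>'" for \<eta> x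
    using that ab(1) particles_upto_eq_0_iff[of \<eta> a] unfolding config_prec_iff by (metis le_zero_eq)
  have fixed': "\<eta> x" if "x > b" "\<eta> \<prec> \<eta>'" for \<eta> x
    using that ab(2) holes_above_eq_0_iff[of \<eta> b] unfolding config_prec_iff by (metis le_zero_eq)
  have "inj_on (\<lambda>\<eta>. {x \<in> {a..b}. \<eta> x}) {\<eta>. \<eta> \<prec> \<eta>'}"
  proof (rule inj_onI, rule ext)
    fix \<eta> \<zeta> x
    assume below: "\<eta> \<in> {\<eta>. \<eta> \<prec> \<eta>'}" "\<zeta> \<in> {\<eta>. \<eta> \<prec> \<eta>'}"
      and eq: "{x \<in> {a..b}. \<eta> x} = {x \<in> {a..b}. \<zeta> x}"
    consider "x \<le> a" | "x > b" | "x \<in> {a..b}" by fastforce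
    then show "\<eta> x = \<zeta> x"
    proof cases
      case 1 then show ?thesis using below fixed by blast
    next
      case 2 then show ?thesis using below fixed' by blast
    next
      case 3 then show ?thesis using eq by blast
    qed
  qed
  moreover have "(\<lambda>\<eta>. {x \<in> {a..b}. \<eta> x}) ` {\<eta>. \<eta> \<prec> \<eta>'} \<subseteq> Pow {a..b}" by auto
  ultimately show ?thesis by (rule inj_on_finite) simp
qed (simp add: config_prec_def)

text \<open>Far to the left both particle counts vanish and far to the right both hole counts vanish; there
the order determines the sign of the difference between the constants in
\<open>particles_minus_holes\<close>, with opposite results. So the constants agree, that is, comparable
configurations lie in the same class, and both counts differ by the same amount.\<close>

lemma config_prec_gap:
  assumes "\<eta> \<prec> \<eta>'"
  shows "int (particles_upto \<eta>' z) - int (particles_upto \<eta> z) =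
    int (holes_above \<eta>' z) - int (holes_above \<eta> z)"
proof -
  have b: "\<eta> \<in> \<X>" "\<eta>' \<in> \<X>" using assms by (auto simp: config_prec_def)
  obtain a where a: "particles_upto \<eta>' a = 0" using ex_particles_upto_eq_0[OF b(2)] by blast
  obtain c where c: "holes_above \<eta>' c = 0" using ex_holes_above_eq_0[OF b(2)] by blast
  have a': "particles_upto \<eta> a = 0" and c': "holes_above \<eta> c = 0"
    using assms a c unfolding config_prec_iff by (metis le_zero_eq)+
  have le: "holes_above \<eta> a \<le> holes_above \<eta>' a" "particles_upto \<eta> c \<le> particles_upto \<eta>' c"
    using assms unfolding config_prec_iff by auto
  note d = particles_minus_holes[OF blocking_finite[OF b(1)]] particles_minus_holes[OF blocking_finite[OF b(2)]]
  show ?thesis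
    using d(1)[of c a] d(2)[of c a] d(1)[of z a] d(2)[of z a] a a' c c' le by linarith
qed

section \<open>The order is preserved by coupled exchanges\<close>

text \<open>The common change of both counting functions when a particle jumps from \<open>x\<close> to \<open>y\<close>: \<open>-1\<close> on
\<open>[x, y)\<close> for a jump to the right, \<open>1\<close> on \<open>[y, x)\<close> for a jump to the left.\<close>

definition exchange_shift :: "int \<Rightarrow> int \<Rightarrow> int \<Rightarrow> int" where
  "exchange_shift x y z = of_bool (y \<le> z) - of_bool (x \<le> z)"

lemma particles_upto_exchange:
  assumes "\<eta> \<in> \<X>" "\<eta> x" "\<not> \<eta> y"
  shows "int (particles_upto (exchange \<eta> x y) z) = int (particles_upto \<eta> z) + exchange_shift x y z"
proof -
  define C where "C = {u. u \<le> z \<and> \<eta> u} - {x}"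
  have fin: "finite C" using blocking_finite(1)[OF assms(1), of z] by (simp add: C_def)
  have "x \<noteq> y" using assms by auto
  then have "{u. u \<le> z \<and> exchange \<eta> x y u} = (if y \<le> z then insert y C else C)"
    using assms by (auto simp: exchange_def C_def)
  moreover have "{u. u \<le> z \<and> \<eta> u} = (if x \<le> z then insert x C else C)"
    using assms by (auto simp: C_def)
  moreover have "x \<notin> C" "y \<notin> C" using assms by (auto simp: C_def)
  ultimately show ?thesis using fin by (auto simp: particles_upto_def exchange_shift_def)
qed

lemma holes_above_exchange:
  assumes "\<eta> \<in> \<X>" "\<eta> x" "\<not> \<eta> y"
  shows "int (holes_above (exchange \<eta> x y) z) = int (holes_above \<eta> z) + exchange_shift x y z"
proof -
  define C where "C = {u. u > z \<and> \<not> \<eta> u} - {y}"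
  have fin: "finite C" using blocking_finite(2)[OF assms(1), of z] by (simp add: C_def)
  have "x \<noteq> y" using assms by auto
  then have "{u. u > z \<and> \<not> exchange \<eta> x y u} = (if x > z then insert x C else C)"
    using assms by (auto simp: exchange_def C_def)
  moreover have "{u. u > z \<and> \<not> \<eta> u} = (if y > z then insert y C else C)"
    using assms by (auto simp: C_def)
  moreover have "x \<notin> C" "y \<notin> C" using assms by (auto simp: C_def)
  ultimately show ?thesis using fin by (auto simp: holes_above_def exchange_shift_def)
qed

lemma particle_pos_occupied: "\<eta> \<in> \<X> \<Longrightarrow> \<eta> (particle_pos \<eta> i)"
  using particle_pos(2)[of \<eta>] by auto

lemma hole_pos_empty: "\<eta> \<in> \<X> \<Longrightarrow> \<not> \<eta> (hole_pos \<eta> j)"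
  using hole_pos(2)[of \<eta>] by auto

text \<open>Between two positions of the \<open>i\<close>-th particle, or of the \<open>j\<close>-th hole, the order is strict. This is
the room needed by the moves below: the shifts caused by coupled jumps differ only there.\<close>

lemma config_prec_gap_pos:
  assumes "\<eta> \<prec> \<eta>'"
    and "(particle_pos \<eta>' i \<le> z \<and> z < particle_pos \<eta> i) \<or> (hole_pos \<eta> j \<le> z \<and> z < hole_pos \<eta>' j)"
  shows "particles_upto \<eta> z < particles_upto \<eta>' z"
proof -
  have b: "\<eta> \<in> \<X>" "\<eta>' \<in> \<X>" using assms by (auto simp: config_prec_def)
  from assms(2) show ?thesis
  proof
    assume "particle_pos \<eta>' i \<le> z \<and> z < particle_pos \<eta> i"
    then show ?thesis
      using less_particles_upto_iff[OF b(1), of i z] less_particles_upto_iff[OF b(2), of i z] by simp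
  next
    assume "hole_pos \<eta> j \<le> z \<and> z < hole_pos \<eta>' j"
    then show ?thesis
      using less_holes_above_iff[OF b(1), of j z] less_holes_above_iff[OF b(2), of j z]
        config_prec_gap[OF assms(1), of z] by simp
  qed
qed

text \<open>By \<open>config_prec_gap\<close> the same inequality settles both the particle counts and the hole counts.\<close>

lemma config_prec_shiftI:
  assumes "\<eta> \<prec> \<eta>'" "\<zeta> \<in> \<X>" "\<zeta>' \<in> \<X>"
    and "\<And>z. int (particles_upto \<zeta> z) = int (particles_upto \<eta> z) + s z"
    and "\<And>z. int (holes_above \<zeta> z) = int (holes_above \<eta> z) + s z"
    and "\<And>z. int (particles_upto \<zeta>' z) = int (particles_upto \<eta>' z) + s' z"
    and "\<And>z. int (holes_above \<zeta>' z) = int (holes_above \<eta>' z) + s' z"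
    and "\<And>z. s z \<le> s' z + (int (particles_upto \<eta>' z) - int (particles_upto \<eta> z))"
  shows "\<zeta> \<prec> \<zeta>'"
proof -
  have "particles_upto \<zeta> z \<le> particles_upto \<zeta>' z" "holes_above \<zeta> z \<le> holes_above \<zeta>' z" for z
    using assms(4-8)[of z] config_prec_gap[OF assms(1), of z] by linarith+
  then show ?thesis using assms(2,3) by (simp add: config_prec_iff)
qed

text \<open>The coupled move of a pair \<open>\<eta> \<prec> \<eta>'\<close> uses the \<open>i\<close>-th particle and the \<open>j\<close>-th hole of both
configurations. Then \<open>x' \<le> x\<close> and \<open>y \<le> y'\<close>, so the jump is to the right in \<open>\<eta>'\<close> whenever it is to
the right in \<open>\<eta>\<close>, and three cases remain: both to the right, both to the left, or to the left in
\<open>\<eta>\<close> and to the right in \<open>\<eta>'\<close>. In the first two cases the pair may move together.\<close>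

context
  fixes \<eta> \<eta>' :: config and i j :: nat and x y x' y' :: int
  assumes prec: "\<eta> \<prec> \<eta>'"
  defines "x \<equiv> particle_pos \<eta> i" and "y \<equiv> hole_pos \<eta> j"
    and "x' \<equiv> particle_pos \<eta>' i" and "y' \<equiv> hole_pos \<eta>' j"
begin

lemma config_prec_blocking: "\<eta> \<in> \<X>" "\<eta>' \<in> \<X>"
  using prec by (auto simp: config_prec_def)

lemma config_prec_pos_le: "x' \<le> x" "y \<le> y'"
  using prec by (auto simp: config_prec_def x_def x'_def y_def y'_def)

lemma config_prec_pos_values: "\<eta> x" "\<not> \<eta> y" "\<eta>' x'" "\<not> \<eta>' y'"
  using config_prec_blocking particle_pos_occupied hole_pos_empty
  by (simp_all add: x_def x'_def y_def y'_def)

lemma coupled_gap_pos: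
  assumes "(x' \<le> z \<and> z < x) \<or> (y \<le> z \<and> z < y')"
  shows "1 \<le> int (particles_upto \<eta>' z) - int (particles_upto \<eta> z)"
  using config_prec_gap_pos[OF prec, of i z j] assms by (simp add: x_def x'_def y_def y'_def)

lemma coupled_gap_nonneg: "0 \<le> int (particles_upto \<eta>' z) - int (particles_upto \<eta> z)"
  using prec by (simp add: config_prec_iff)

lemma coupled_exchange_counts:
  "exchange \<eta> x y \<in> \<X>" "exchange \<eta>' x' y' \<in> \<X>"
  "int (particles_upto (exchange \<eta> x y) z) = int (particles_upto \<eta> z) + exchange_shift x y z"
  "int (holes_above (exchange \<eta> x y) z) = int (holes_above \<eta> z) + exchange_shift x y z"
  "int (particles_upto (exchange \<eta>' x' y') z) = int (particles_upto \<eta>' z) + exchange_shift x' y' z"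
  "int (holes_above (exchange \<eta>' x' y') z) = int (holes_above \<eta>' z) + exchange_shift x' y' z"
  using particles_upto_exchange[OF config_prec_blocking(1) config_prec_pos_values(1,2)]
    holes_above_exchange[OF config_prec_blocking(1) config_prec_pos_values(1,2)]
    particles_upto_exchange[OF config_prec_blocking(2) config_prec_pos_values(3,4)]
    holes_above_exchange[OF config_prec_blocking(2) config_prec_pos_values(3,4)] exchange_blocking config_prec_blocking
  by auto

lemma exchange_both_prec:
  assumes "x < y \<or> y' < x'"
  shows "exchange \<eta> x y \<prec> exchange \<eta>' x' y'"
proof (rule config_prec_shiftI[OF prec coupled_exchange_counts])
  fix z
  show "exchange_shift x y z \<le> exchange_shift x' y' z +
      (int (particles_upto \<eta>' z) - int (particles_upto \<eta> z))"
    using coupled_gap_pos[of z] coupled_gap_nonneg[of z] config_prec_pos_le assms unfolding exchange_shift_def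
    by (auto simp: of_bool_def)
qed

text \<open>The lower configuration may move alone either to the right or in the third case: then every site
of \<open>[y, x)\<close> is not left of \<open>x'\<close> or is left of \<open>y'\<close>, where there is a gap.\<close>

lemma exchange_lower_prec:
  assumes "x < y \<or> x' < y'"
  shows "exchange \<eta> x y \<prec> \<eta>'"
proof (rule config_prec_shiftI[OF prec coupled_exchange_counts(1) config_prec_blocking(2) coupled_exchange_counts(3,4),
    where s' = "\<lambda>_. 0"])
  fix z
  show "exchange_shift x y z \<le> 0 + (int (particles_upto \<eta>' z) - int (particles_upto \<eta> z))"
    using coupled_gap_pos[of z] coupled_gap_nonneg[of z] config_prec_pos_le assms unfolding exchange_shift_def
    by (cases "x' \<le> z"; cases "z < y'") (auto simp: of_bool_def)
qed auto

text \<open>The mirror image of \<open>exchange_lower_prec\<close>.\<close>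

lemma prec_exchange_upper:
  assumes "y' < x' \<or> y < x"
  shows "\<eta> \<prec> exchange \<eta>' x' y'"
proof (rule config_prec_shiftI[OF prec config_prec_blocking(1) coupled_exchange_counts(2) _ _ coupled_exchange_counts(5,6),
    where s = "\<lambda>_. 0"])
  fix z
  show "0 \<le> exchange_shift x' y' z + (int (particles_upto \<eta>' z) - int (particles_upto \<eta> z))"
    using coupled_gap_pos[of z] coupled_gap_nonneg[of z] config_prec_pos_le assms unfolding exchange_shift_def
    by (cases "x \<le> z"; cases "z < y") (auto simp: of_bool_def)
qed auto

end

section \<open>The minimal transition semigroup\<close>

text \<open>The off-diagonal part of the generator applied to \<open>g\<close>.\<close>

definition jump_sum :: "rates \<Rightarrow> (config \<Rightarrow> ennreal) \<Rightarrow> config \<Rightarrow> ennreal" where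
  "jump_sum p g \<eta> =
     (\<integral>\<^sup>+ xy. ennreal (p (fst xy) (snd xy) \<eta>) * g (exchange \<eta> (fst xy) (snd xy)) \<partial>count_space UNIV)"

text \<open>The expectation of \<open>f\<close> at time \<open>t\<close> on the event of at most \<open>n\<close> jumps. Allowing a general \<open>f\<close> in place
of the indicator of a state makes \<open>P\<^sub>s P\<^sub>t\<close> expressible without sums over states.\<close>

primrec jump_semigroup_upto :: "rates \<Rightarrow> (config \<Rightarrow> ennreal) \<Rightarrow> nat \<Rightarrow> real \<Rightarrow> config \<Rightarrow> ennreal" where
  "jump_semigroup_upto p f 0 t \<eta> = ennreal (exp (- total_rate p \<eta> * t)) * f \<eta>"
| "jump_semigroup_upto p f (Suc n) t \<eta> =
     ennreal (exp (- total_rate p \<eta> * t)) * f \<eta> +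
     (\<integral>\<^sup>+ s\<in>{0..t}. ennreal (exp (- total_rate p \<eta> * s)) *
        jump_sum p (jump_semigroup_upto p f n (t - s)) \<eta> \<partial>lborel)"

definition jump_semigroup :: "rates \<Rightarrow> (config \<Rightarrow> ennreal) \<Rightarrow> real \<Rightarrow> config \<Rightarrow> ennreal" where
  "jump_semigroup p f t \<eta> = (SUP n. jump_semigroup_upto p f n t \<eta>)"

lemma trans_upto_eq: "trans_upto p n t \<eta> \<zeta> = jump_semigroup_upto p (indicator {\<zeta>}) n t \<eta>"
  by (induction n arbitrary: t \<eta>) (simp_all add: jump_sum_def)

lemma trans_prob_eq: "trans_prob p t \<eta> \<zeta> = jump_semigroup p (indicator {\<zeta>}) t \<eta>"
  by (simp add: trans_prob_def jump_semigroup_def trans_upto_eq)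

lemma jump_sum_mono: "(\<And>\<zeta>. g \<zeta> \<le> h \<zeta>) \<Longrightarrow> jump_sum p g \<eta> \<le> jump_sum p h \<eta>"
  unfolding jump_sum_def by (intro nn_integral_mono mult_left_mono) auto

text \<open>There are countably many pairs of sites, so a jump sum is a series of measurable functions.\<close>

lemma measurable_jump_sum:
  assumes "\<And>\<zeta>. (\<lambda>u. g u \<zeta>) \<in> borel_measurable M"
  shows "(\<lambda>u. jump_sum p (g u) \<eta>) \<in> borel_measurable M"
proof -
  have eq: "jump_sum p (g u) \<eta> = (\<Sum>n. ennreal (p (fst (pair n)) (snd (pair n)) \<eta>) *
      g u (exchange \<eta> (fst (pair n)) (snd (pair n))))"
    if "pair = from_nat_into (UNIV :: (int \<times> int) set)" for u pair
  proof -
    have "bij_betw pair UNIV UNIV"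
      unfolding that by (rule bij_betw_from_nat_into) (auto simp: finite_prod)
    from nn_integral_bij_count_space[OF this, symmetric] show ?thesis
      unfolding jump_sum_def by (simp add: nn_integral_count_space_nat)
  qed
  show ?thesis
    unfolding eq[OF refl] using assms by measurable
qed

lemma jump_sum_SUP:
  assumes "incseq g"
  shows "jump_sum p (\<lambda>\<zeta>. SUP n. g n \<zeta>) \<eta> = (SUP n. jump_sum p (g n) \<eta>)"
proof -
  have "jump_sum p (\<lambda>\<zeta>. SUP n. g n \<zeta>) \<eta> = (\<integral>\<^sup>+ xy. (SUP n. ennreal (p (fst xy) (snd xy) \<eta>) *
      g n (exchange \<eta> (fst xy) (snd xy))) \<partial>count_space UNIV)"
    unfolding jump_sum_def by (simp add: SUP_mult_left_ennreal)
  also have "\<dots> = (SUP n. jump_sum p (g n) \<eta>)"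
    unfolding jump_sum_def
    by (rule nn_integral_monotone_convergence_SUP)
      (use assms in \<open>auto simp: incseq_def le_fun_def intro!: mult_left_mono\<close>)
  finally show ?thesis .
qed

definition exp_convolution :: "real \<Rightarrow> (real \<Rightarrow> ennreal) \<Rightarrow> real \<Rightarrow> ennreal" where
  "exp_convolution q G t = (\<integral>\<^sup>+ s\<in>{0..t}. ennreal (exp (- q * s)) * G (t - s) \<partial>lborel)"

lemma exp_convolution_mono:
  "(\<And>s. 0 \<le> s \<Longrightarrow> s \<le> t \<Longrightarrow> G s \<le> H s) \<Longrightarrow> exp_convolution q G t \<le> exp_convolution q H t"
  unfolding exp_convolution_def
  by (intro nn_integral_mono) (auto simp: indicator_def intro!: mult_left_mono)

lemma borel_measurable_indicator_atLeastAtMost [measurable]: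
  fixes a b :: "'a \<Rightarrow> real"
  assumes [measurable]: "a \<in> borel_measurable M" "b \<in> borel_measurable M"
  shows "(\<lambda>x. indicator {0..a x} (b x) :: ennreal) \<in> borel_measurable M"
proof -
  have "(\<lambda>x. indicator {0..a x} (b x) :: ennreal) = (\<lambda>x. if 0 \<le> b x \<and> b x \<le> a x then 1 else 0)"
    by (auto simp: indicator_def)
  then show ?thesis by simp
qed

lemma measurable_exp_convolution [measurable]:
  assumes [measurable]: "G \<in> borel_measurable borel"
  shows "exp_convolution q G \<in> borel_measurable borel"
proof -
  have "(\<lambda>x. ennreal (exp (- q * snd x)) * G (fst x - snd x) * indicator {0..fst x} (snd x))
      \<in> borel_measurable (borel \<Otimes>\<^sub>M borel)"
    by measurable
  then have "(\<lambda>(t, s). ennreal (exp (- q * s)) * G (t - s) * indicator {0..t} s)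
      \<in> borel_measurable (borel \<Otimes>\<^sub>M lborel)"
    by (simp add: case_prod_beta')
  from lborel.borel_measurable_nn_integral[OF this] show ?thesis
    unfolding exp_convolution_def[abs_def] .
qed

lemma exp_convolution_SUP:
  assumes inc: "incseq G" and [measurable]: "\<And>n. G n \<in> borel_measurable borel"
  shows "exp_convolution q (\<lambda>s. SUP n. G n s) t = (SUP n. exp_convolution q (G n) t)"
proof -
  have "exp_convolution q (\<lambda>s. SUP n. G n s) t =
      (\<integral>\<^sup>+ s. (SUP n. ennreal (exp (- q * s)) * G n (t - s) * indicator {0..t} s) \<partial>lborel)"
    unfolding exp_convolution_def by (simp add: SUP_mult_left_ennreal SUP_mult_right_ennreal)
  also have "\<dots> = (SUP n. exp_convolution q (G n) t)"
    unfolding exp_convolution_def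
    by (rule nn_integral_monotone_convergence_SUP)
      (use inc in \<open>auto simp: incseq_def le_fun_def intro!: mult_left_mono mult_right_mono\<close>)
  finally show ?thesis .
qed

lemma ennreal_exp_add: "c = a + b \<Longrightarrow> ennreal (exp c) = ennreal (exp a) * ennreal (exp b)"
  by (simp add: exp_add ennreal_mult)

text \<open>A waiting time that exceeds \<open>s\<close> restarts at time \<open>s\<close>, with the factor \<open>exp (- q * s)\<close>.\<close>

lemma exp_convolution_split:
  assumes [measurable]: "G \<in> borel_measurable borel" and st: "0 \<le> s" "0 \<le> t"
  shows "exp_convolution q G (s + t) =
    exp_convolution q (\<lambda>r. G (r + t)) s + ennreal (exp (- q * s)) * exp_convolution q G t"
proof -
  let ?F = "\<lambda>r. ennreal (exp (- q * r)) * G (s + t - r)"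
  have "exp_convolution q G (s + t) = (\<integral>\<^sup>+ r. ?F r * indicator {0..s+t} r \<partial>lborel)"
    by (simp add: exp_convolution_def)
  also have "\<dots> = (\<integral>\<^sup>+ r. ?F r * indicator {0..s} r + ?F r * indicator {s..s+t} r \<partial>lborel)"
    by (rule nn_integral_cong_AE, use AE_lborel_singleton[of s] in eventually_elim)
      (use st in \<open>auto simp: indicator_def\<close>)
  also have "\<dots> = (\<integral>\<^sup>+ r. ?F r * indicator {0..s} r \<partial>lborel) + (\<integral>\<^sup>+ r. ?F r * indicator {s..s+t} r \<partial>lborel)"
    by (rule nn_integral_add) auto
  also have "(\<integral>\<^sup>+ r. ?F r * indicator {0..s} r \<partial>lborel) = exp_convolution q (\<lambda>r. G (r + t)) s"
    unfolding exp_convolution_def by (simp add: algebra_simps)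
  also have "(\<integral>\<^sup>+ r. ?F r * indicator {s..s+t} r \<partial>lborel) =
      (\<integral>\<^sup>+ r. ?F (s + r) * indicator {s..s+t} (s + r) \<partial>lborel)"
    using nn_integral_real_affine[of "\<lambda>r. ?F r * indicator {s..s+t} r" 1 s] by simp
  also have "\<dots> = (\<integral>\<^sup>+ r. ennreal (exp (- q * s)) * (ennreal (exp (- q * r)) * G (t - r) * indicator {0..t} r) \<partial>lborel)"
  proof (rule nn_integral_cong)
    fix r
    have "ennreal (exp (- q * (s + r))) = ennreal (exp (- q * s)) * ennreal (exp (- q * r))"
      by (rule ennreal_exp_add) (simp add: algebra_simps)
    then show "?F (s + r) * indicator {s..s+t} (s + r) =
        ennreal (exp (- q * s)) * (ennreal (exp (- q * r)) * G (t - r) * indicator {0..t} r)"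
      by (simp add: indicator_def mult.assoc)
  qed
  also have "\<dots> = ennreal (exp (- q * s)) * exp_convolution q G t"
    unfolding exp_convolution_def by (rule nn_integral_cmult) auto
  finally show ?thesis .
qed

lemma nn_integral_exp:
  assumes "0 < a"
  shows "(\<integral>\<^sup>+ t\<in>{0..}. ennreal (exp (- a * t)) \<partial>lborel) = ennreal (1 / a)"
proof -
  have "(\<integral>\<^sup>+ t\<in>{0..}. ennreal (exp (- a * t)) \<partial>lborel) = 0 - (- exp (- a * 0) / a)"
  proof (rule nn_integral_FTC_atLeast)
    show "((\<lambda>t. - exp (- a * t) / a) \<longlongrightarrow> 0) at_top"
      using assms by real_asymp
  qed (use assms in \<open>auto intro!: derivative_eq_intros\<close>)
  then show ?thesis by simp
qed

text \<open>Laplace transforms turn the convolution into a product; this is what makes the comparison of the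
two processes algebraic.\<close>

lemma laplace_exp_convolution:
  assumes [measurable]: "G \<in> borel_measurable borel" and l: "\<alpha> + q > 0"
  shows "(\<integral>\<^sup>+ t\<in>{0..}. ennreal (exp (- \<alpha> * t)) * exp_convolution q G t \<partial>lborel) =
    ennreal (1 / (\<alpha> + q)) * (\<integral>\<^sup>+ t\<in>{0..}. ennreal (exp (- \<alpha> * t)) * G t \<partial>lborel)"
    (is "?L = _ * ?R")
proof -
  have "?L = (\<integral>\<^sup>+ t. \<integral>\<^sup>+ s. ennreal (exp (- \<alpha> * t)) * (ennreal (exp (- q * s)) * G (t - s)) *
      indicator {0..t} s \<partial>lborel \<partial>lborel)"
  proof (rule nn_integral_cong)
    fix t
    have "ennreal (exp (- \<alpha> * t)) * exp_convolution q G t * indicator {0..} t =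
        (\<integral>\<^sup>+ s. (ennreal (exp (- \<alpha> * t)) * indicator {0..} t) *
          (ennreal (exp (- q * s)) * G (t - s) * indicator {0..t} s) \<partial>lborel)"
      unfolding exp_convolution_def by (subst nn_integral_cmult) (auto simp: mult_ac)
    also have "\<dots> = (\<integral>\<^sup>+ s. ennreal (exp (- \<alpha> * t)) * (ennreal (exp (- q * s)) * G (t - s)) *
      indicator {0..t} s \<partial>lborel)"
      by (intro nn_integral_cong) (auto simp: indicator_def mult.assoc)
    finally show "ennreal (exp (- \<alpha> * t)) * exp_convolution q G t * indicator {0..} t = \<dots>" .
  qed
  also have "\<dots> = (\<integral>\<^sup>+ s. \<integral>\<^sup>+ t. ennreal (exp (- \<alpha> * t)) * (ennreal (exp (- q * s)) * G (t - s)) *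
      indicator {0..t} s \<partial>lborel \<partial>lborel)"
  proof (rule lborel_pair.Fubini')
    have "(\<lambda>x. ennreal (exp (- \<alpha> * snd x)) * (ennreal (exp (- q * fst x)) * G (snd x - fst x)) *
        indicator {0..snd x} (fst x)) \<in> borel_measurable (borel \<Otimes>\<^sub>M borel)"
      by measurable
    then show "(\<lambda>(s, t). ennreal (exp (- \<alpha> * t)) * (ennreal (exp (- q * s)) * G (t - s)) *
        indicator {0..t} s) \<in> borel_measurable (lborel \<Otimes>\<^sub>M lborel)"
      by (simp add: case_prod_beta')
  qed
  also have "\<dots> = (\<integral>\<^sup>+ s. ennreal (exp (- (\<alpha> + q) * s)) * indicator {0..} s * ?R \<partial>lborel)"
  proof (rule nn_integral_cong)
    fix s :: real
    have "(\<integral>\<^sup>+ t. ennreal (exp (- \<alpha> * t)) * (ennreal (exp (- q * s)) * G (t - s)) * indicator {0..t} s \<partial>lborel) =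
       (\<integral>\<^sup>+ t. ennreal (exp (- \<alpha> * (s + t))) * (ennreal (exp (- q * s)) * G t) * indicator {0..s + t} s \<partial>lborel)"
      using nn_integral_real_affine[of "\<lambda>t. ennreal (exp (- \<alpha> * t)) * (ennreal (exp (- q * s)) * G (t - s)) * indicator {0..t} s" 1 s]
      by simp
    also have "\<dots> = (\<integral>\<^sup>+ t. ennreal (exp (- (\<alpha> + q) * s)) * indicator {0..} s *
        (ennreal (exp (- \<alpha> * t)) * G t * indicator {0..} t) \<partial>lborel)"
    proof (rule nn_integral_cong)
      fix t
      have e1: "ennreal (exp (- \<alpha> * (s + t))) = ennreal (exp (- \<alpha> * s)) * ennreal (exp (- \<alpha> * t))"
        by (rule ennreal_exp_add) (simp add: algebra_simps)
      have e2: "ennreal (exp (- (\<alpha> + q) * s)) = ennreal (exp (- \<alpha> * s)) * ennreal (exp (- q * s))"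
        by (rule ennreal_exp_add) (simp add: algebra_simps)
      show "ennreal (exp (- \<alpha> * (s + t))) * (ennreal (exp (- q * s)) * G t) *
          indicator {0..s + t} s = ennreal (exp (- (\<alpha> + q) * s)) * indicator {0..} s *
          (ennreal (exp (- \<alpha> * t)) * G t * indicator {0..} t)"
        unfolding e1 e2 by (auto simp: indicator_def mult_ac)
    qed
    also have "\<dots> = ennreal (exp (- (\<alpha> + q) * s)) * indicator {0..} s * ?R"
      by (rule nn_integral_cmult) auto
    finally show "(\<integral>\<^sup>+ t. ennreal (exp (- \<alpha> * t)) * (ennreal (exp (- q * s)) * G (t - s)) * indicator {0..t} s \<partial>lborel) = \<dots>" .
  qed
  also have "\<dots> = ennreal (1 / (\<alpha> + q)) * ?R"
    using nn_integral_exp[OF l] by (simp add: nn_integral_multc)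
  finally show ?thesis .
qed

lemma jump_semigroup_upto_Suc:
  "jump_semigroup_upto p f (Suc n) t \<eta> = ennreal (exp (- total_rate p \<eta> * t)) * f \<eta> +
     exp_convolution (total_rate p \<eta>) (\<lambda>s. jump_sum p (jump_semigroup_upto p f n s) \<eta>) t"
  by (simp add: exp_convolution_def)

declare jump_semigroup_upto.simps(2) [simp del]

lemma measurable_semigroup_upto [measurable]:
  "(\<lambda>t. jump_semigroup_upto p f n t \<eta>) \<in> borel_measurable borel"
proof (induction n arbitrary: \<eta>)
  case (Suc n)
  have [measurable]: "(\<lambda>s. jump_sum p (jump_semigroup_upto p f n s) \<eta>) \<in> borel_measurable borel"
    by (rule measurable_jump_sum) (rule Suc)
  show ?case unfolding jump_semigroup_upto_Suc by measurable
qed simp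

lemma incseq_semigroup_upto: "incseq (\<lambda>n. jump_semigroup_upto p f n t \<eta>)"
proof (rule incseq_SucI)
  show "jump_semigroup_upto p f n t \<eta> \<le> jump_semigroup_upto p f (Suc n) t \<eta>" for n
  proof (induction n arbitrary: t \<eta>)
    case (Suc n)
    show ?case
      unfolding jump_semigroup_upto_Suc[of p f "Suc n" t \<eta>] jump_semigroup_upto_Suc[of p f n t \<eta>]
      by (intro add_left_mono exp_convolution_mono jump_sum_mono Suc)
  qed (simp add: jump_semigroup_upto_Suc)
qed

lemma jump_semigroup_upto_le_semigroup: "jump_semigroup_upto p f n t \<eta> \<le> jump_semigroup p f t \<eta>"
  unfolding jump_semigroup_def by (rule SUP_upper) simp

lemma measurable_semigroup [measurable]: "(\<lambda>t. jump_semigroup p f t \<eta>) \<in> borel_measurable borel"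
  unfolding jump_semigroup_def by measurable

lemma measurable_jump_sum_semigroup_upto [measurable]:
  "(\<lambda>t. jump_sum p (jump_semigroup_upto p f n t) \<eta>) \<in> borel_measurable borel"
  by (rule measurable_jump_sum) measurable

lemma measurable_jump_sum_semigroup [measurable]:
  "(\<lambda>t. jump_sum p (jump_semigroup p f t) \<eta>) \<in> borel_measurable borel"
  by (rule measurable_jump_sum) measurable

lemma SUP_Suc_incseq:
  fixes X :: "nat \<Rightarrow> ennreal"
  assumes "incseq X"
  shows "(SUP n. X (Suc n)) = (SUP n. X n)"
  using assms by (intro antisym SUP_mono) (auto simp: incseq_Suc_iff)

lemma jump_sum_semigroup:
  "jump_sum p (jump_semigroup p f t) \<eta> = (SUP n. jump_sum p (jump_semigroup_upto p f n t) \<eta>)"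
proof -
  have "incseq (\<lambda>n. jump_semigroup_upto p f n t)"
    using incseq_semigroup_upto by (auto simp: incseq_def le_fun_def)
  from jump_sum_SUP[OF this] show ?thesis by (simp add: jump_semigroup_def[abs_def])
qed

text \<open>Kolmogorov's backward equation in integrated form: conditioning on the first jump.\<close>

lemma jump_semigroup_backward:
  "jump_semigroup p f t \<eta> = ennreal (exp (- total_rate p \<eta> * t)) * f \<eta> +
     exp_convolution (total_rate p \<eta>) (\<lambda>s. jump_sum p (jump_semigroup p f s) \<eta>) t"
proof -
  have inc: "incseq (\<lambda>n s. jump_sum p (jump_semigroup_upto p f n s) \<eta>)"
    using incseq_semigroup_upto by (auto simp: incseq_def le_fun_def intro!: jump_sum_mono)
  have "jump_semigroup p f t \<eta> = (SUP n. jump_semigroup_upto p f (Suc n) t \<eta>)"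
    unfolding jump_semigroup_def by (rule SUP_Suc_incseq[symmetric]) (rule incseq_semigroup_upto)
  also have "\<dots> = ennreal (exp (- total_rate p \<eta> * t)) * f \<eta> + (SUP n.
      exp_convolution (total_rate p \<eta>) (\<lambda>s. jump_sum p (jump_semigroup_upto p f n s) \<eta>) t)"
    unfolding jump_semigroup_upto_Suc by (rule ennreal_SUP_add_right[symmetric]) simp
  also have "(SUP n. exp_convolution (total_rate p \<eta>) (\<lambda>s. jump_sum p (jump_semigroup_upto p f n s) \<eta>) t) =
      exp_convolution (total_rate p \<eta>) (\<lambda>s. jump_sum p (jump_semigroup p f s) \<eta>) t"
    unfolding jump_sum_semigroup by (rule exp_convolution_SUP[symmetric]) (use inc in auto)
  finally show ?thesis .
qed

lemma jump_semigroup_upto_flow: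
  assumes "0 \<le> s" "0 \<le> t"
  shows "jump_semigroup_upto p f (Suc n) (s + t) \<eta> =
    ennreal (exp (- total_rate p \<eta> * s)) * jump_semigroup_upto p f (Suc n) t \<eta> +
    exp_convolution (total_rate p \<eta>) (\<lambda>r. jump_sum p (jump_semigroup_upto p f n (r + t)) \<eta>) s"
proof -
  have "ennreal (exp (- total_rate p \<eta> * (s + t))) =
      ennreal (exp (- total_rate p \<eta> * s)) * ennreal (exp (- total_rate p \<eta> * t))"
    by (rule ennreal_exp_add) (simp add: algebra_simps)
  then show ?thesis
    unfolding jump_semigroup_upto_Suc by (subst exp_convolution_split) (use assms in \<open>auto simp: algebra_simps\<close>)
qed

text \<open>Conditioning on the first jump before time \<open>s\<close>, for a total time \<open>s + t\<close>. This form of the backward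
equation is the induction step for the semigroup property.\<close>

lemma jump_semigroup_flow:
  assumes "0 \<le> s" "0 \<le> t"
  shows "jump_semigroup p f (s + t) \<eta> = ennreal (exp (- total_rate p \<eta> * s)) * jump_semigroup p f t \<eta> +
    exp_convolution (total_rate p \<eta>) (\<lambda>r. jump_sum p (jump_semigroup p f (r + t)) \<eta>) s"
proof -
  have "ennreal (exp (- total_rate p \<eta> * (s + t))) =
      ennreal (exp (- total_rate p \<eta> * s)) * ennreal (exp (- total_rate p \<eta> * t))"
    by (rule ennreal_exp_add) (simp add: algebra_simps)
  then show ?thesis
    unfolding jump_semigroup_backward[of p f "s + t"] jump_semigroup_backward[of p f t \<eta>]
    by (subst exp_convolution_split) (use assms in \<open>auto simp: algebra_simps\<close>)
qed

text \<open>The Chapman--Kolmogorov equation. Each inequality is an induction over the number of jumps made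
in the quantity on its left, while the other side satisfies the same recursion without a bound on
the number of jumps.\<close>

lemma jump_semigroup_add:
  assumes s: "0 \<le> s" and t: "0 \<le> t"
  shows "jump_semigroup p (jump_semigroup p f t) s \<eta> = jump_semigroup p f (s + t) \<eta>"
proof (rule antisym)
  have "jump_semigroup_upto p (jump_semigroup p f t) n s \<eta> \<le> jump_semigroup p f (s + t) \<eta>" if "0 \<le> s" for n s \<eta>
    using that
  proof (induction n arbitrary: s \<eta>)
    case 0
    then show ?case by (simp add: jump_semigroup_flow[OF _ t])
  next
    case (Suc n)
    show ?case
      unfolding jump_semigroup_upto_Suc jump_semigroup_flow[OF Suc.prems t]
      by (intro add_left_mono exp_convolution_mono jump_sum_mono Suc.IH)
  qed
  then show "jump_semigroup p (jump_semigroup p f t) s \<eta> \<le> jump_semigroup p f (s + t) \<eta>"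
    unfolding jump_semigroup_def[of p "jump_semigroup p f t"] using s by (intro SUP_least)
next
  have "jump_semigroup_upto p f n (s + t) \<eta> \<le> jump_semigroup p (jump_semigroup p f t) s \<eta>" if "0 \<le> s" for n s \<eta>
    using that
  proof (induction n arbitrary: s \<eta>)
    case 0
    have "jump_semigroup_upto p f 0 (s + t) \<eta> =
        ennreal (exp (- total_rate p \<eta> * s)) * jump_semigroup_upto p f 0 t \<eta>"
      by (simp add: ennreal_exp_add[of _ "- total_rate p \<eta> * s" "- total_rate p \<eta> * t"] algebra_simps)
    also have "\<dots> \<le> ennreal (exp (- total_rate p \<eta> * s)) * jump_semigroup p f t \<eta>"
      by (intro mult_left_mono jump_semigroup_upto_le_semigroup) simp
    also have "\<dots> \<le> jump_semigroup p (jump_semigroup p f t) s \<eta>"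
      by (subst jump_semigroup_backward) simp
    finally show ?case .
  next
    case (Suc n)
    show ?case
      unfolding jump_semigroup_upto_flow[OF Suc.prems t] jump_semigroup_backward[of p "jump_semigroup p f t" s \<eta>]
      by (intro add_mono mult_left_mono exp_convolution_mono jump_sum_mono Suc.IH
          jump_semigroup_upto_le_semigroup) auto
  qed
  then show "jump_semigroup p f (s + t) \<eta> \<le> jump_semigroup p (jump_semigroup p f t) s \<eta>"
    unfolding jump_semigroup_def[of p f] using s by (intro SUP_least)
qed

lemma jump_sum_count_space:
  assumes "countable X"
  shows "jump_sum p (\<lambda>\<zeta>. \<integral>\<^sup>+ \<xi>. g \<xi> \<zeta> \<partial>count_space X) \<eta> = (\<integral>\<^sup>+ \<xi>. jump_sum p (g \<xi>) \<eta> \<partial>count_space X)"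
  unfolding jump_sum_def
  by (subst nn_integral_count_space_nn_integral[OF assms, symmetric])
    (auto simp: nn_integral_cmult)

lemma exp_convolution_count_space:
  assumes "countable X" and [measurable]: "\<And>\<xi>. \<xi> \<in> X \<Longrightarrow> g \<xi> \<in> borel_measurable borel"
  shows "exp_convolution q (\<lambda>s. \<integral>\<^sup>+ \<xi>. g \<xi> s \<partial>count_space X) t =
    (\<integral>\<^sup>+ \<xi>. exp_convolution q (g \<xi>) t \<partial>count_space X)"
  unfolding exp_convolution_def
  by (subst nn_integral_count_space_nn_integral[OF assms(1), symmetric])
    (auto simp: nn_integral_cmult nn_integral_multc)

lemma jump_sum_cmult: "jump_sum p (\<lambda>\<zeta>. c * g \<zeta>) \<eta> = c * jump_sum p g \<eta>"
  unfolding jump_sum_def by (subst nn_integral_cmult[symmetric]) (auto simp: mult_ac)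

lemma exp_convolution_cmult:
  assumes [measurable]: "G \<in> borel_measurable borel"
  shows "exp_convolution q (\<lambda>s. c * G s) t = c * exp_convolution q G t"
  unfolding exp_convolution_def by (subst nn_integral_cmult[symmetric]) (auto simp: mult_ac)

lemma jump_sum_cong_blocking:
  assumes "\<eta> \<in> \<X>" "\<And>\<zeta>. \<zeta> \<in> \<X> \<Longrightarrow> g \<zeta> = h \<zeta>"
  shows "jump_sum p g \<eta> = jump_sum p h \<eta>"
  unfolding jump_sum_def using assms exchange_blocking by simp

lemma jump_semigroup_upto_eq_nn_integral:
  assumes "\<eta> \<in> \<X>"
  shows "jump_semigroup_upto p f n t \<eta> =
    (\<integral>\<^sup>+ \<xi>. f \<xi> * jump_semigroup_upto p (indicator {\<xi>}) n t \<eta> \<partial>count_space \<X>)"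
  using assms
proof (induction n arbitrary: t \<eta>)
  have base: "(\<integral>\<^sup>+ \<xi>. f \<xi> * (c * indicator {\<xi>} \<eta>) \<partial>count_space \<X>) = c * f \<eta>"
    if "\<eta> \<in> \<X>" for \<eta> c
  proof -
    have "(\<integral>\<^sup>+ \<xi>. f \<xi> * (c * indicator {\<xi>} \<eta>) \<partial>count_space \<X>) =
        (\<integral>\<^sup>+ \<xi>. c * f \<eta> * indicator {\<eta>} \<xi> \<partial>count_space \<X>)"
      by (intro nn_integral_cong) (auto simp: indicator_def mult.commute)
    also have "\<dots> = c * f \<eta>"
      using that by (subst nn_integral_cmult_indicator) auto
    finally show ?thesis .
  qed
  {
    case 0
    then show ?case by (simp add: base)
  next
    case (Suc n)
    let ?q = "total_rate p \<eta>"
    have "jump_semigroup_upto p f (Suc n) t \<eta> = ennreal (exp (- ?q * t)) * f \<eta> +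
        exp_convolution ?q (\<lambda>s. jump_sum p (\<lambda>\<zeta>. \<integral>\<^sup>+ \<xi>. f \<xi> * jump_semigroup_upto p (indicator {\<xi>}) n s \<zeta>
          \<partial>count_space \<X>) \<eta>) t"
      unfolding jump_semigroup_upto_Suc using jump_sum_cong_blocking[OF Suc.prems Suc.IH] by simp
    also have "\<dots> = (\<integral>\<^sup>+ \<xi>. f \<xi> * (ennreal (exp (- ?q * t)) * indicator {\<xi>} \<eta>) \<partial>count_space \<X>) +
       (\<integral>\<^sup>+ \<xi>. f \<xi> * exp_convolution ?q (\<lambda>s. jump_sum p (jump_semigroup_upto p (indicator {\<xi>}) n s) \<eta>) t
          \<partial>count_space \<X>)"
      by (simp add: base[OF Suc.prems] jump_sum_count_space exp_convolution_count_space
          countable_blocking_configs jump_sum_cmult exp_convolution_cmult)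
    also have "\<dots> = (\<integral>\<^sup>+ \<xi>. f \<xi> * jump_semigroup_upto p (indicator {\<xi>}) (Suc n) t \<eta> \<partial>count_space \<X>)"
      unfolding jump_semigroup_upto_Suc by (subst nn_integral_add[symmetric]) (auto simp: distrib_left)
    finally show ?case .
  }
qed

text \<open>Only states in \<open>\<X>\<close> are reached, so the sum over these countably many states recovers \<open>P\<^sub>t f\<close> from the
transition probabilities.\<close>

lemma jump_semigroup_eq_nn_integral:
  assumes "\<eta> \<in> \<X>"
  shows "jump_semigroup p f t \<eta> =
    (\<integral>\<^sup>+ \<xi>. f \<xi> * jump_semigroup p (indicator {\<xi>}) t \<eta> \<partial>count_space \<X>)"
proof -
  have "jump_semigroup p f t \<eta> = (SUP n. \<integral>\<^sup>+ \<xi>. f \<xi> * jump_semigroup_upto p (indicator {\<xi>}) n t \<eta> \<partial>count_space \<X>)"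
    unfolding jump_semigroup_def by (intro SUP_cong refl jump_semigroup_upto_eq_nn_integral[OF assms])
  also have "\<dots> = (\<integral>\<^sup>+ \<xi>. (SUP n. f \<xi> * jump_semigroup_upto p (indicator {\<xi>}) n t \<eta>) \<partial>count_space \<X>)"
    by (rule nn_integral_monotone_convergence_SUP[symmetric])
      (use incseq_semigroup_upto in \<open>auto simp: incseq_def le_fun_def intro!: mult_left_mono\<close>)
  finally show ?thesis by (simp add: jump_semigroup_def SUP_mult_left_ennreal)
qed

lemma exclusion_rates_nonneg: "exclusion_rates p \<Longrightarrow> 0 \<le> p x y \<eta>"
  by (simp add: exclusion_rates_def)

lemma exclusion_rates_eq_0: "exclusion_rates p \<Longrightarrow> \<not> (\<eta> x \<and> \<not> \<eta> y) \<Longrightarrow> p x y \<eta> = 0"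
  by (simp add: exclusion_rates_def)

lemma total_rate_nonneg: "exclusion_rates p \<Longrightarrow> 0 \<le> total_rate p \<eta>"
  unfolding total_rate_def by (intro infsum_nonneg) (auto simp: exclusion_rates_nonneg)

lemma jump_sum_const:
  assumes p: "exclusion_rates p" and \<eta>: "\<eta> \<in> \<X>"
  shows "jump_sum p (\<lambda>_. c) \<eta> = ennreal (total_rate p \<eta>) * c"
proof -
  let ?f = "\<lambda>xy. p (fst xy) (snd xy) \<eta>"
  have "?f summable_on UNIV"
    using p \<eta> by (auto simp: exclusion_rates_def case_prod_beta')
  then have abs: "Infinite_Sum.abs_summable_on ?f UNIV"
    using p by (simp add: exclusion_rates_nonneg)
  have "(\<integral>\<^sup>+ xy. ennreal (?f xy) \<partial>count_space UNIV) = ennreal (infsetsum ?f UNIV)"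
    using abs p by (intro nn_integral_conv_infsetsum)
      (auto simp: abs_summable_equivalent[symmetric] exclusion_rates_nonneg)
  also have "infsetsum ?f UNIV = total_rate p \<eta>"
    using abs by (subst infsetsum_infsum) (auto simp: total_rate_def case_prod_beta' abs_summable_equivalent[symmetric])
  finally show ?thesis by (simp add: jump_sum_def nn_integral_multc)
qed

text \<open>The waiting time either exceeds \<open>t\<close> or ends before.\<close>

lemma exp_convolution_const:
  assumes "0 \<le> q" "0 \<le> t"
  shows "ennreal (exp (- q * t)) + exp_convolution q (\<lambda>_. ennreal q) t = 1"
proof -
  have "exp_convolution q (\<lambda>_. ennreal q) t = (\<integral>\<^sup>+ s. ennreal (q * exp (- q * s)) * indicator {0..t} s \<partial>lborel)"
    unfolding exp_convolution_def using assms by (simp add: ennreal_mult mult_ac)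
  also have "\<dots> = ennreal (- exp (- q * t) - - exp (- q * 0))"
    by (rule nn_integral_FTC_Icc) (use assms in \<open>auto intro!: derivative_eq_intros\<close>)
  finally show ?thesis
    using assms by (simp add: ennreal_plus[symmetric] del: ennreal_plus)
qed

lemma jump_semigroup_le_1:
  assumes p: "exclusion_rates p" and f: "\<And>\<zeta>. f \<zeta> \<le> 1" and "\<eta> \<in> \<X>" "0 \<le> t"
  shows "jump_semigroup p f t \<eta> \<le> 1"
proof -
  have "jump_semigroup_upto p f n t \<eta> \<le> 1" for n
    using assms(3,4)
  proof (induction n arbitrary: t \<eta>)
    case 0
    have "jump_semigroup_upto p f 0 t \<eta> \<le> ennreal (exp (- total_rate p \<eta> * t)) * 1"
      unfolding jump_semigroup_upto.simps by (intro mult_left_mono f) simp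
    also have "\<dots> \<le> 1" using 0 total_rate_nonneg[OF p, of \<eta>] by simp
    finally show ?case .
  next
    case (Suc n)
    let ?q = "total_rate p \<eta>"
    have *: "jump_sum p (jump_semigroup_upto p f n s) \<eta> \<le> ennreal ?q" if "0 \<le> s" for s
    proof -
      have "jump_sum p (jump_semigroup_upto p f n s) \<eta> =
          jump_sum p (\<lambda>\<zeta>. jump_semigroup_upto p f n s \<zeta> * indicator \<X> \<zeta>) \<eta>"
        by (rule jump_sum_cong_blocking) (use Suc in auto)
      also have "\<dots> \<le> jump_sum p (\<lambda>_. 1) \<eta>"
        by (rule jump_sum_mono) (use Suc.IH that in \<open>auto simp: indicator_def\<close>)
      finally show ?thesis using jump_sum_const[OF p Suc.prems(1)] by simp
    qed
    have "jump_semigroup_upto p f (Suc n) t \<eta> \<le> ennreal (exp (- ?q * t)) * 1 + exp_convolution ?q (\<lambda>_. ennreal ?q) t"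
      unfolding jump_semigroup_upto_Suc by (intro add_mono mult_left_mono exp_convolution_mono * f) auto
    also have "\<dots> = 1" using exp_convolution_const[OF total_rate_nonneg[OF p] Suc.prems(2)] by simp
    finally show ?case .
  qed
  then show ?thesis unfolding jump_semigroup_def by (intro SUP_least)
qed

section \<open>The resolvent\<close>

definition resolvent :: "rates \<Rightarrow> real \<Rightarrow> (config \<Rightarrow> ennreal) \<Rightarrow> config \<Rightarrow> ennreal" where
  "resolvent p \<alpha> f \<eta> = (\<integral>\<^sup>+ t\<in>{0..}. ennreal (exp (- \<alpha> * t)) * jump_semigroup p f t \<eta> \<partial>lborel)"

text \<open>The recursion of \<open>jump_semigroup_upto\<close> after a Laplace transform in time, starting one step
earlier so that the comparison below has a trivial base case.\<close>

primrec resolvent_upto :: "rates \<Rightarrow> real \<Rightarrow> (config \<Rightarrow> ennreal) \<Rightarrow> nat \<Rightarrow> config \<Rightarrow> ennreal" where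
  "resolvent_upto p \<alpha> f 0 \<eta> = 0"
| "resolvent_upto p \<alpha> f (Suc n) \<eta> =
     ennreal (1 / (\<alpha> + total_rate p \<eta>)) * (f \<eta> + jump_sum p (resolvent_upto p \<alpha> f n) \<eta>)"

lemma jump_sum_laplace:
  assumes [measurable]: "\<And>\<zeta>. (\<lambda>t. g t \<zeta>) \<in> borel_measurable borel"
  shows "(\<integral>\<^sup>+ t\<in>{0..}. ennreal (exp (- \<alpha> * t)) * jump_sum p (g t) \<eta> \<partial>lborel) =
    jump_sum p (\<lambda>\<zeta>. \<integral>\<^sup>+ t\<in>{0..}. ennreal (exp (- \<alpha> * t)) * g t \<zeta> \<partial>lborel) \<eta>"
proof -
  let ?X = "UNIV :: (int \<times> int) set"
  have "(\<integral>\<^sup>+ t\<in>{0..}. ennreal (exp (- \<alpha> * t)) * jump_sum p (g t) \<eta> \<partial>lborel) =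
      (\<integral>\<^sup>+ t. \<integral>\<^sup>+ xy. ennreal (p (fst xy) (snd xy) \<eta>) * (ennreal (exp (- \<alpha> * t)) *
        g t (exchange \<eta> (fst xy) (snd xy)) * indicator {0..} t) \<partial>count_space ?X \<partial>lborel)"
    unfolding jump_sum_def
    by (intro nn_integral_cong) (simp add: nn_integral_cmult[symmetric] nn_integral_multc[symmetric] mult_ac)
  also have "\<dots> = (\<integral>\<^sup>+ xy. \<integral>\<^sup>+ t. ennreal (p (fst xy) (snd xy) \<eta>) * (ennreal (exp (- \<alpha> * t)) *
        g t (exchange \<eta> (fst xy) (snd xy)) * indicator {0..} t) \<partial>lborel \<partial>count_space ?X)"
    by (rule nn_integral_count_space_nn_integral) auto
  also have "\<dots> = jump_sum p (\<lambda>\<zeta>. \<integral>\<^sup>+ t\<in>{0..}. ennreal (exp (- \<alpha> * t)) * g t \<zeta> \<partial>lborel) \<eta>"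
    unfolding jump_sum_def by (simp add: nn_integral_cmult)
  finally show ?thesis .
qed

lemma laplace_semigroup_upto:
  assumes p: "exclusion_rates p" and \<alpha>: "0 < \<alpha>"
  shows "(\<integral>\<^sup>+ t\<in>{0..}. ennreal (exp (- \<alpha> * t)) * jump_semigroup_upto p f n t \<eta> \<partial>lborel) =
    resolvent_upto p \<alpha> f (Suc n) \<eta>"
proof (induction n arbitrary: \<eta>)
  have pos: "0 < \<alpha> + total_rate p \<eta>" for \<eta> using total_rate_nonneg[OF p, of \<eta>] \<alpha> by linarith
  have base: "(\<integral>\<^sup>+ t\<in>{0..}. ennreal (exp (- \<alpha> * t)) * (ennreal (exp (- total_rate p \<eta> * t)) * f \<eta>) \<partial>lborel) =
    ennreal (1 / (\<alpha> + total_rate p \<eta>)) * f \<eta>" for \<eta>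
  proof -
    have "ennreal (exp (- \<alpha> * t)) * (ennreal (exp (- total_rate p \<eta> * t)) * f \<eta>) * indicator {0..} t =
        ennreal (exp (- (\<alpha> + total_rate p \<eta>) * t)) * indicator {0..} t * f \<eta>" for t
      by (subst ennreal_exp_add[of "- (\<alpha> + total_rate p \<eta>) * t" "- \<alpha> * t" "- total_rate p \<eta> * t"])
        (simp_all add: algebra_simps)
    then show ?thesis by (simp only: nn_integral_exp[OF pos, symmetric]) (rule nn_integral_multc, simp)
  qed
  {
    case 0
    show ?case using base by (simp add: jump_sum_def)
  next
    case (Suc n)
    let ?q = "total_rate p \<eta>"
    have "(\<integral>\<^sup>+ t\<in>{0..}. ennreal (exp (- \<alpha> * t)) * jump_semigroup_upto p f (Suc n) t \<eta> \<partial>lborel) =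
       (\<integral>\<^sup>+ t\<in>{0..}. ennreal (exp (- \<alpha> * t)) * (ennreal (exp (- ?q * t)) * f \<eta>) \<partial>lborel) +
       (\<integral>\<^sup>+ t\<in>{0..}. ennreal (exp (- \<alpha> * t)) *
          exp_convolution ?q (\<lambda>s. jump_sum p (jump_semigroup_upto p f n s) \<eta>) t \<partial>lborel)"
      unfolding jump_semigroup_upto_Suc
      by (subst nn_integral_add[symmetric]) (auto simp: distrib_left distrib_right)
    also have "\<dots> = ennreal (1 / (\<alpha> + ?q)) * f \<eta> + ennreal (1 / (\<alpha> + ?q)) *
        jump_sum p (resolvent_upto p \<alpha> f (Suc n)) \<eta>"
      unfolding base laplace_exp_convolution[OF measurable_jump_sum_semigroup_upto pos]
        jump_sum_laplace[OF measurable_semigroup_upto] Suc.IH ..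
    finally show ?case by (simp only: resolvent_upto.simps(2)[of _ _ _ "Suc n"] distrib_left)
  }
qed

lemma incseq_resolvent_upto: "incseq (\<lambda>n. resolvent_upto p \<alpha> f n \<eta>)"
proof (rule incseq_SucI)
  show "resolvent_upto p \<alpha> f n \<eta> \<le> resolvent_upto p \<alpha> f (Suc n) \<eta>" for n
  proof (induction n arbitrary: \<eta>)
    case (Suc n)
    show ?case
      unfolding resolvent_upto.simps(2)[of p \<alpha> f "Suc n" \<eta>] resolvent_upto.simps(2)[of p \<alpha> f n \<eta>]
      by (intro add_left_mono mult_left_mono jump_sum_mono Suc) auto
  qed simp
qed

lemma resolvent_eq_SUP:
  assumes "exclusion_rates p" "0 < \<alpha>"
  shows "resolvent p \<alpha> f \<eta> = (SUP n. resolvent_upto p \<alpha> f n \<eta>)"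
proof -
  have "resolvent p \<alpha> f \<eta> = (\<integral>\<^sup>+ t. (SUP n. ennreal (exp (- \<alpha> * t)) * jump_semigroup_upto p f n t \<eta> *
      indicator {0..} t) \<partial>lborel)"
    unfolding resolvent_def jump_semigroup_def by (simp add: SUP_mult_left_ennreal SUP_mult_right_ennreal)
  also have "\<dots> = (SUP n. resolvent_upto p \<alpha> f (Suc n) \<eta>)"
    unfolding laplace_semigroup_upto[OF assms, symmetric]
    by (rule nn_integral_monotone_convergence_SUP)
      (use incseq_semigroup_upto in \<open>auto simp: incseq_def le_fun_def intro!: mult_left_mono mult_right_mono\<close>)
  also have "\<dots> = (SUP n. resolvent_upto p \<alpha> f n \<eta>)"
    by (rule SUP_Suc_incseq) (rule incseq_resolvent_upto)
  finally show ?thesis .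
qed

text \<open>The equation \<open>(\<alpha> - L) r = f\<close> for the generator \<open>L\<close>, with the negative terms moved to the left.\<close>

lemma resolvent_equation:
  assumes "exclusion_rates p" "0 < \<alpha>"
  shows "ennreal (\<alpha> + total_rate p \<eta>) * resolvent p \<alpha> f \<eta> = f \<eta> + jump_sum p (resolvent p \<alpha> f) \<eta>"
proof -
  have pos: "0 < \<alpha> + total_rate p \<eta>" using total_rate_nonneg[OF assms(1), of \<eta>] assms(2) by linarith
  have inc: "incseq (\<lambda>n. resolvent_upto p \<alpha> f n)"
    using incseq_resolvent_upto by (auto simp: incseq_def le_fun_def)
  have "resolvent p \<alpha> f \<eta> = (SUP n. resolvent_upto p \<alpha> f (Suc n) \<eta>)"
    unfolding resolvent_eq_SUP[OF assms] by (rule SUP_Suc_incseq[symmetric]) (rule incseq_resolvent_upto)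
  also have "\<dots> = ennreal (1 / (\<alpha> + total_rate p \<eta>)) * (f \<eta> + jump_sum p (resolvent p \<alpha> f) \<eta>)"
    unfolding resolvent_eq_SUP[OF assms, abs_def] jump_sum_SUP[OF inc]
    by (simp add: SUP_mult_left_ennreal ennreal_SUP_add_right)
  finally have "ennreal (\<alpha> + total_rate p \<eta>) * resolvent p \<alpha> f \<eta> =
      ennreal (\<alpha> + total_rate p \<eta>) * ennreal (1 / (\<alpha> + total_rate p \<eta>)) * (f \<eta> + jump_sum p (resolvent p \<alpha> f) \<eta>)"
    by (simp add: mult.assoc)
  then show ?thesis using pos by (simp add: ennreal_mult[symmetric])
qed

lemma resolvent_le:
  assumes p: "exclusion_rates p" and \<alpha>: "0 < \<alpha>" and f: "\<And>\<zeta>. f \<zeta> \<le> 1"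
    and \<eta>: "\<eta> \<in> \<X>"
  shows "resolvent p \<alpha> f \<eta> \<le> ennreal (1 / \<alpha>)"
proof -
  have "resolvent p \<alpha> f \<eta> \<le> (\<integral>\<^sup>+ t\<in>{0..}. ennreal (exp (- \<alpha> * t)) \<partial>lborel)"
    unfolding resolvent_def
  proof (rule nn_integral_mono)
    fix t :: real
    show "ennreal (exp (- \<alpha> * t)) * jump_semigroup p f t \<eta> * indicator {0..} t \<le>
        ennreal (exp (- \<alpha> * t)) * indicator {0..} t"
      using mult_left_mono[OF jump_semigroup_le_1[OF p f \<eta>, of t], of "ennreal (exp (- \<alpha> * t))"]
      by (auto simp: indicator_def)
  qed
  then show ?thesis by (simp only: nn_integral_exp[OF \<alpha>])
qed

section \<open>Comparison of resolvents\<close>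

text \<open>Indexing the jumps by the numbers of the particle and of the hole is the coupling: it pairs the
jumps out of two different configurations.\<close>

lemma jump_sum_enumeration:
  assumes p: "exclusion_rates p" and \<eta>: "\<eta> \<in> \<X>"
  shows "jump_sum p g \<eta> = (\<integral>\<^sup>+ ij. ennreal (p (particle_pos \<eta> (fst ij)) (hole_pos \<eta> (snd ij)) \<eta>) *
    g (exchange \<eta> (particle_pos \<eta> (fst ij)) (hole_pos \<eta> (snd ij))) \<partial>count_space UNIV)"
proof -
  let ?P = "{x. \<eta> x} \<times> {y. \<not> \<eta> y}"
  let ?F = "\<lambda>xy. ennreal (p (fst xy) (snd xy) \<eta>) * g (exchange \<eta> (fst xy) (snd xy))"
  let ?h = "map_prod (particle_pos \<eta>) (hole_pos \<eta>)"
  have "bij_betw (particle_pos \<eta>) UNIV {x. \<eta> x}"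
    using particle_pos[OF \<eta>] by (simp add: bij_betw_def strict_mono_imp_inj_on)
  moreover have "bij_betw (hole_pos \<eta>) UNIV {y. \<not> \<eta> y}"
    using hole_pos(2)[OF \<eta>] strict_mono_imp_inj_on[OF hole_pos(1)[OF \<eta>], of UNIV]
    by (auto simp: bij_betw_def inj_on_def)
  ultimately have "bij_betw ?h UNIV ?P"
    using bij_betw_map_prod by fastforce
  then have "(\<integral>\<^sup>+ ij. ?F (?h ij) \<partial>count_space UNIV) = (\<integral>\<^sup>+ xy. ?F xy \<partial>count_space ?P)"
    by (rule nn_integral_bij_count_space)
  also have "\<dots> = (\<integral>\<^sup>+ xy. ?F xy * indicator ?P xy \<partial>count_space UNIV)"
    by (rule nn_integral_count_space_indicator) simp
  also have "\<dots> = jump_sum p g \<eta>"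
    unfolding jump_sum_def
  proof (rule nn_integral_cong)
    fix xy
    show "?F xy * indicator ?P xy = ?F xy"
      using exclusion_rates_eq_0[OF p, of \<eta> "fst xy" "snd xy"]
      by (cases "xy \<in> ?P") (auto simp: mem_Times_iff)
  qed
  finally show ?thesis by simp
qed

text \<open>The hypothesis on the rates: relative to \<open>pbar\<close>, the rates \<open>p\<close> favour jumps to the right, which
lower a configuration, and hinder jumps to the left.\<close>

definition dominates :: "rates \<Rightarrow> rates \<Rightarrow> bool" where
  "dominates pbar p \<longleftrightarrow>
    (\<forall>\<eta> \<eta>' x y x' y'. \<eta> \<prec> \<eta>' \<longrightarrow> \<eta> x \<longrightarrow> \<eta>' x' \<longrightarrow> \<not> \<eta> y \<longrightarrow> \<not> \<eta>' y' \<longrightarrow>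
      (x' \<le> x \<longrightarrow> x < y \<longrightarrow> y \<le> y' \<longrightarrow> pbar x' y' \<eta>' \<le> p x y \<eta>) \<and>
      (y \<le> y' \<longrightarrow> y' < x' \<longrightarrow> x' \<le> x \<longrightarrow> p x y \<eta> \<le> pbar x' y' \<eta>'))"

text \<open>The contribution of one particle and one hole. The rates in the lower and in the upper
configuration are \<open>a\<close> and \<open>a'\<close>, the values before the jump \<open>r\<close> and \<open>v\<close>, those after it \<open>e\<close> and
\<open>e'\<close>. The claim is \<open>a' (e' - v) \<le> a (e - r)\<close>, free of subtraction, and the three alternatives
are the three cases of the coupling.\<close>

lemma coupled_terms_le:
  fixes a a' v r e e' :: real
  assumes "0 \<le> a" "0 \<le> a'" "r \<le> v"
    and "(a' \<le> a \<and> e' \<le> e \<and> r \<le> e) \<or> (a \<le> a' \<and> e' \<le> e \<and> e' \<le> r) \<or> (r \<le> e \<and> e' \<le> r)"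
  shows "a' * e' + a * r \<le> a * e + a' * v"
  using assms(4)
proof (elim disjE conjE)
  assume "a' \<le> a" "e' \<le> e" "r \<le> e"
  then have "a' * (e' - v) \<le> a' * (e - r)" "a' * (e - r) \<le> a * (e - r)"
    using assms by (auto intro!: mult_left_mono mult_right_mono)
  then show ?thesis by (simp add: algebra_simps)
next
  assume *: "a \<le> a'" "e' \<le> e" "e' \<le> r"
  then have "a' * (r - e') \<ge> a * (r - e')" "a * (r - e') \<ge> a * (r - e)" "a' * (v - e') \<ge> a' * (r - e')"
    using assms by (auto intro!: mult_left_mono mult_right_mono)
  then show ?thesis by (simp add: algebra_simps)
next
  assume "r \<le> e" "e' \<le> r"
  then have "a * r \<le> a * e" "a' * e' \<le> a' * v"
    using assms by (auto intro!: mult_left_mono)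
  then show ?thesis by linarith
qed

lemma coupled_terms_le_ennreal:
  fixes v r e e' :: ennreal
  assumes "0 \<le> a" "0 \<le> a'" "r \<le> v" and fin: "v < \<infinity>" "r < \<infinity>" "e < \<infinity>" "e' < \<infinity>"
    and "(a' \<le> a \<and> e' \<le> e \<and> r \<le> e) \<or> (a \<le> a' \<and> e' \<le> e \<and> e' \<le> r) \<or> (r \<le> e \<and> e' \<le> r)"
  shows "ennreal a' * e' + ennreal a * r \<le> ennreal a * e + ennreal a' * v"
proof -
  have "a' * enn2real e' + a * enn2real r \<le> a * enn2real e + a' * enn2real v"
    by (rule coupled_terms_le) (use assms in \<open>auto intro: enn2real_mono simp: less_top\<close>)
  then have "ennreal (a' * enn2real e' + a * enn2real r) \<le> ennreal (a * enn2real e + a' * enn2real v)"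
    by (rule ennreal_leI)
  then show ?thesis using assms(1,2) fin by (simp add: ennreal_mult less_top)
qed

text \<open>Cancelling the common terms leaves \<open>\<alpha> v \<le> \<alpha> r\<close>.\<close>

lemma le_of_weighted_le:
  fixes v r :: ennreal
  assumes "0 < \<alpha>" "0 \<le> q" "0 \<le> q'" "v < \<infinity>" "r < \<infinity>"
    and le: "ennreal (\<alpha> + q') * v + ennreal q * r \<le> ennreal (\<alpha> + q) * r + ennreal q' * v"
  shows "v \<le> r"
proof -
  obtain v' r' where v: "v = ennreal v'" "0 \<le> v'" and r: "r = ennreal r'" "0 \<le> r'"
    using assms(4,5) by (metis ennreal_cases infinity_ennreal_def less_irrefl)
  have "(\<alpha> + q') * v' + q * r' \<le> (\<alpha> + q) * r' + q' * v'"
    using le assms(1-3) v r by (simp add: ennreal_mult[symmetric] ennreal_plus[symmetric] del: ennreal_plus)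
  then have "\<alpha> * v' \<le> \<alpha> * r'" by (simp add: algebra_simps)
  then show ?thesis using assms(1) v r by simp
qed

lemma resolvent_upto_le_resolvent:
  assumes "exclusion_rates p" "0 < \<alpha>"
  shows "resolvent_upto p \<alpha> f n \<eta> \<le> resolvent p \<alpha> f \<eta>"
  unfolding resolvent_eq_SUP[OF assms] by (rule SUP_upper) simp

text \<open>Suppose that \<open>\<xi>\<close> minimises the lower resolvent among the finitely many configurations below \<open>\<eta>'\<close>,
and that the claim fails there. A jump of the lower configuration that stays below \<open>\<eta>'\<close> does not
decrease the resolvent, by the choice of \<open>\<xi>\<close>; a jump of the upper configuration is controlled by
the induction hypothesis. So the jump terms compare in favour of \<open>\<xi>\<close>, and the resolvent equations
give the claim after all.\<close>

lemma resolvent_upto_dominated: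
  assumes p: "exclusion_rates p" and pbar: "exclusion_rates pbar" and dom: "dominates pbar p"
    and \<alpha>: "0 < \<alpha>" and f: "\<And>\<zeta>. f \<zeta> \<le> 1"
    and dec: "\<And>\<zeta> \<zeta>'. \<zeta> \<prec> \<zeta>' \<Longrightarrow> f \<zeta>' \<le> f \<zeta>"
    and "\<eta> \<prec> \<eta>'"
  shows "resolvent_upto pbar \<alpha> f n \<eta>' \<le> resolvent p \<alpha> f \<eta>"
  using \<open>\<eta> \<prec> \<eta>'\<close>
proof (induction n arbitrary: \<eta> \<eta>')
  case (Suc n)
  let ?r = "resolvent p \<alpha> f" and ?v = "resolvent_upto pbar \<alpha> f (Suc n) \<eta>'"
  let ?e' = "resolvent_upto pbar \<alpha> f n"
  have fin_r: "?r \<zeta> < \<infinity>" if "\<zeta> \<in> \<X>" for \<zeta>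
    using resolvent_le[where f = f, OF p \<alpha> f that] by (simp add: order_le_less_trans)
  have fin_e': "resolvent_upto pbar \<alpha> f m \<zeta> < \<infinity>" if "\<zeta> \<in> \<X>" for \<zeta> m
    using resolvent_le[where f = f, OF pbar \<alpha> f that] resolvent_upto_le_resolvent[OF pbar \<alpha>, of f m \<zeta>]
    by (metis ennreal_less_top infinity_ennreal_def leD leI order_trans)
  \<comment> \<open>\<open>\<eta>\<close> itself is one of the candidates, so it is enough to compare at the minimum\<close>
  obtain \<xi> where \<xi>: "\<xi> \<prec> \<eta>'" and min: "\<And>\<zeta>. \<zeta> \<prec> \<eta>' \<Longrightarrow> ?r \<xi> \<le> ?r \<zeta>"
  proof -
    have "finite (?r ` {\<zeta>. \<zeta> \<prec> \<eta>'})" "?r ` {\<zeta>. \<zeta> \<prec> \<eta>'} \<noteq> {}"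
      using finite_config_prec_below Suc.prems by auto
    from Min_in[OF this] Min_le[OF this(1)] show ?thesis using that by auto
  qed
  have b: "\<xi> \<in> \<X>" "\<eta>' \<in> \<X>" using \<xi> by (auto simp: config_prec_def)
  have "?v \<le> ?r \<xi>"
  proof (rule ccontr)
    assume "\<not> ?v \<le> ?r \<xi>"
    then have less: "?r \<xi> < ?v" by simp
    let ?x = "particle_pos \<xi>" and ?y = "hole_pos \<xi>" and ?x' = "particle_pos \<eta>'" and ?y' = "hole_pos \<eta>'"
    \<comment> \<open>the jump of particle \<open>i\<close> to hole \<open>j\<close> in both configurations, with all terms made positive\<close>
    have terms: "ennreal (pbar (?x' i) (?y' j) \<eta>') * ?e' (exchange \<eta>' (?x' i) (?y' j)) +
        ennreal (p (?x i) (?y j) \<xi>) * ?r \<xi> \<le>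
        ennreal (p (?x i) (?y j) \<xi>) * ?r (exchange \<xi> (?x i) (?y j)) +
        ennreal (pbar (?x' i) (?y' j) \<eta>') * ?v" for i j
    proof (rule coupled_terms_le_ennreal)
      let ?E = "exchange \<xi> (?x i) (?y j)" and ?E' = "exchange \<eta>' (?x' i) (?y' j)"
      note pos = config_prec_pos_le(1)[OF \<xi>, of i] config_prec_pos_le(2)[OF \<xi>, of j] config_prec_pos_values(1)[OF \<xi>, of i]
        config_prec_pos_values(2)[OF \<xi>, of j] config_prec_pos_values(3)[OF \<xi>, of i] config_prec_pos_values(4)[OF \<xi>, of j]
      have ne: "?x i \<noteq> ?y j" "?x' i \<noteq> ?y' j" using pos by auto
      consider "?x i < ?y j" | "?y' j < ?x' i" | "?y j < ?x i" "?x' i < ?y' j"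
        using ne by linarith
      then show "(pbar (?x' i) (?y' j) \<eta>' \<le> p (?x i) (?y j) \<xi> \<and> ?e' ?E' \<le> ?r ?E \<and> ?r \<xi> \<le> ?r ?E) \<or>
        (p (?x i) (?y j) \<xi> \<le> pbar (?x' i) (?y' j) \<eta>' \<and> ?e' ?E' \<le> ?r ?E \<and> ?e' ?E' \<le> ?r \<xi>) \<or>
        (?r \<xi> \<le> ?r ?E \<and> ?e' ?E' \<le> ?r \<xi>)"
      proof cases
        case 1
        then have "pbar (?x' i) (?y' j) \<eta>' \<le> p (?x i) (?y j) \<xi>"
          using dom \<xi> pos unfolding dominates_def by blast
        moreover have "?e' ?E' \<le> ?r ?E" "?r \<xi> \<le> ?r ?E"
          using Suc.IH exchange_both_prec[OF \<xi>] min exchange_lower_prec[OF \<xi>] 1 by blast+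
        ultimately show ?thesis by blast
      next
        case 2
        then have "p (?x i) (?y j) \<xi> \<le> pbar (?x' i) (?y' j) \<eta>'"
          using dom \<xi> pos unfolding dominates_def by blast
        moreover have "?e' ?E' \<le> ?r ?E" "?e' ?E' \<le> ?r \<xi>"
          using Suc.IH exchange_both_prec[OF \<xi>] prec_exchange_upper[OF \<xi>] 2 by blast+
        ultimately show ?thesis by blast
      next
        case 3
        then have "?r \<xi> \<le> ?r ?E" "?e' ?E' \<le> ?r \<xi>"
          using Suc.IH prec_exchange_upper[OF \<xi>] min exchange_lower_prec[OF \<xi>] by blast+
        then show ?thesis by blast
      qed
    qed (use less p pbar b fin_r fin_e' exchange_blocking in
        \<open>auto simp: exclusion_rates_nonneg simp del: resolvent_upto.simps(2)\<close>)
    let ?q = "total_rate p \<xi>" and ?q' = "total_rate pbar \<eta>'"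
    have "jump_sum pbar ?e' \<eta>' + jump_sum p (\<lambda>_. ?r \<xi>) \<xi> \<le>
        jump_sum p ?r \<xi> + jump_sum pbar (\<lambda>_. ?v) \<eta>'"
      unfolding jump_sum_enumeration[OF p b(1)] jump_sum_enumeration[OF pbar b(2)]
      by (subst (1 2) nn_integral_add[symmetric]) (auto intro!: nn_integral_mono terms simp del: resolvent_upto.simps(2))
    then have sums: "jump_sum pbar ?e' \<eta>' + ennreal ?q * ?r \<xi> \<le> jump_sum p ?r \<xi> + ennreal ?q' * ?v"
      by (simp only: jump_sum_const[OF p b(1)] jump_sum_const[OF pbar b(2)])
    have q: "0 \<le> ?q" "0 \<le> ?q'" using total_rate_nonneg p pbar by auto
    have eq': "ennreal (\<alpha> + ?q') * ?v = f \<eta>' + jump_sum pbar ?e' \<eta>'"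
    proof -
      have "ennreal (\<alpha> + ?q') * ennreal (1 / (\<alpha> + ?q')) = 1"
        using q \<alpha> by (simp add: ennreal_mult[symmetric] del: ennreal_plus)
      then show ?thesis by (simp only: resolvent_upto.simps mult.assoc[symmetric] mult_1)
    qed
    have "ennreal (\<alpha> + ?q') * ?v + ennreal ?q * ?r \<xi> = f \<eta>' + (jump_sum pbar ?e' \<eta>' + ennreal ?q * ?r \<xi>)"
      unfolding eq' by (simp add: add.assoc)
    also have "\<dots> \<le> f \<xi> + (jump_sum p ?r \<xi> + ennreal ?q' * ?v)"
      by (intro add_mono sums dec \<xi>)
    also have "\<dots> = ennreal (\<alpha> + ?q) * ?r \<xi> + ennreal ?q' * ?v"
      unfolding resolvent_equation[OF p \<alpha>] by (simp add: add.assoc)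
    finally have "?v \<le> ?r \<xi>"
      using le_of_weighted_le[OF \<alpha> q] fin_r[OF b(1)] fin_e'[OF b(2), of "Suc n"] by blast
    then show False using less by simp
  qed
  also have "?r \<xi> \<le> ?r \<eta>" by (rule min) (rule Suc.prems)
  finally show ?case .
qed simp

lemma resolvent_dominated:
  assumes "exclusion_rates p" "exclusion_rates pbar" "dominates pbar p" "0 < \<alpha>" "\<And>\<zeta>. f \<zeta> \<le> 1"
    and "\<And>\<zeta> \<zeta>'. \<zeta> \<prec> \<zeta>' \<Longrightarrow> f \<zeta>' \<le> f \<zeta>" and "\<eta> \<prec> \<eta>'"
  shows "resolvent pbar \<alpha> f \<eta>' \<le> resolvent p \<alpha> f \<eta>"
  unfolding resolvent_eq_SUP[OF assms(2,4)]
  by (rule SUP_least) (rule resolvent_upto_dominated[OF assms])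

section \<open>Abel means of the law of the process\<close>

text \<open>The expectation of \<open>f\<close> at an independent exponential time with parameter \<open>\<alpha>\<close>, for the process
started from \<open>\<mu>\<close>. The integral runs over the countable set \<open>\<X>\<close>, so that it commutes with integrals
over time.\<close>

definition abel_mean :: "rates \<Rightarrow> config pmf \<Rightarrow> real \<Rightarrow> (config \<Rightarrow> ennreal) \<Rightarrow> ennreal" where
  "abel_mean p \<mu> \<alpha> f = ennreal \<alpha> * (\<integral>\<^sup>+ \<eta>. ennreal (pmf \<mu> \<eta>) * resolvent p \<alpha> f \<eta> \<partial>count_space \<X>)"

lemma nn_integral_pmf_blocking:
  assumes "set_pmf \<mu> \<subseteq> \<X>"
  shows "(\<integral>\<^sup>+ \<eta>. g \<eta> \<partial>measure_pmf \<mu>) = (\<integral>\<^sup>+ \<eta>. ennreal (pmf \<mu> \<eta>) * g \<eta> \<partial>count_space \<X>)"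
proof -
  have "(\<integral>\<^sup>+ \<eta>. ennreal (pmf \<mu> \<eta>) * g \<eta> \<partial>count_space \<X>) =
      (\<integral>\<^sup>+ \<eta>. ennreal (pmf \<mu> \<eta>) * g \<eta> * indicator \<X> \<eta> \<partial>count_space UNIV)"
    by (rule nn_integral_count_space_indicator) simp
  also have "\<dots> = (\<integral>\<^sup>+ \<eta>. ennreal (pmf \<mu> \<eta>) * g \<eta> \<partial>count_space UNIV)"
    using assms by (intro nn_integral_cong) (auto simp: indicator_def set_pmf_iff)
  finally show ?thesis by (simp add: nn_integral_measure_pmf)
qed

lemma resolvent_eq_nn_integral:
  assumes "\<eta> \<in> \<X>"
  shows "resolvent p \<alpha> f \<eta> = (\<integral>\<^sup>+ \<xi>. f \<xi> * resolvent p \<alpha> (indicator {\<xi>}) \<eta> \<partial>count_space \<X>)"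
proof -
  have "resolvent p \<alpha> f \<eta> = (\<integral>\<^sup>+ t. \<integral>\<^sup>+ \<xi>. f \<xi> * (ennreal (exp (- \<alpha> * t)) *
      jump_semigroup p (indicator {\<xi>}) t \<eta> * indicator {0..} t) \<partial>count_space \<X> \<partial>lborel)"
    unfolding resolvent_def
    by (subst jump_semigroup_eq_nn_integral[OF assms])
      (simp add: nn_integral_cmult[symmetric] nn_integral_multc[symmetric] mult_ac)
  also have "\<dots> = (\<integral>\<^sup>+ \<xi>. \<integral>\<^sup>+ t. f \<xi> * (ennreal (exp (- \<alpha> * t)) *
      jump_semigroup p (indicator {\<xi>}) t \<eta> * indicator {0..} t) \<partial>lborel \<partial>count_space \<X>)"
    by (rule nn_integral_count_space_nn_integral) (auto simp: countable_blocking_configs)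
  also have "\<dots> = (\<integral>\<^sup>+ \<xi>. f \<xi> * resolvent p \<alpha> (indicator {\<xi>}) \<eta> \<partial>count_space \<X>)"
    unfolding resolvent_def by (simp add: nn_integral_cmult)
  finally show ?thesis .
qed

lemma nn_integral_count_space_swap:
  fixes f :: "'a \<Rightarrow> 'b \<Rightarrow> ennreal"
  assumes "countable B"
  shows "(\<integral>\<^sup>+ a. \<integral>\<^sup>+ b. f a b \<partial>count_space B \<partial>count_space A) =
    (\<integral>\<^sup>+ b. \<integral>\<^sup>+ a. f a b \<partial>count_space A \<partial>count_space B)"
  by (rule nn_integral_count_space_nn_integral[OF assms]) simp

lemma abel_mean_eq_nn_integral:
  "abel_mean p \<mu> \<alpha> f = (\<integral>\<^sup>+ \<xi>. f \<xi> * abel_mean p \<mu> \<alpha> (indicator {\<xi>}) \<partial>count_space \<X>)"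
proof -
  have "abel_mean p \<mu> \<alpha> f = ennreal \<alpha> * (\<integral>\<^sup>+ \<eta>. \<integral>\<^sup>+ \<xi>. ennreal (pmf \<mu> \<eta>) *
      (f \<xi> * resolvent p \<alpha> (indicator {\<xi>}) \<eta>) \<partial>count_space \<X> \<partial>count_space \<X>)"
    unfolding abel_mean_def
    by (intro arg_cong[where f = "\<lambda>u. ennreal \<alpha> * u"] nn_integral_cong)
      (simp add: resolvent_eq_nn_integral[of _ p \<alpha> f] nn_integral_cmult)
  also have "\<dots> = ennreal \<alpha> * (\<integral>\<^sup>+ \<xi>. \<integral>\<^sup>+ \<eta>. f \<xi> * (ennreal (pmf \<mu> \<eta>) *
      resolvent p \<alpha> (indicator {\<xi>}) \<eta>) \<partial>count_space \<X> \<partial>count_space \<X>)"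
    by (subst nn_integral_count_space_swap[OF countable_blocking_configs]) (simp add: mult_ac)
  also have "\<dots> = (\<integral>\<^sup>+ \<xi>. f \<xi> * abel_mean p \<mu> \<alpha> (indicator {\<xi>}) \<partial>count_space \<X>)"
    unfolding abel_mean_def by (simp add: nn_integral_cmult[symmetric] mult_ac)
  finally show ?thesis .
qed

lemma pmf_blocking_mass:
  assumes "set_pmf \<mu> \<subseteq> \<X>"
  shows "(\<integral>\<^sup>+ \<eta>. ennreal (pmf \<mu> \<eta>) \<partial>count_space \<X>) = 1"
  using nn_integral_pmf_blocking[OF assms, of "\<lambda>_. 1"] by simp

lemma abel_mean_le_1:
  assumes "exclusion_rates p" "set_pmf \<mu> \<subseteq> \<X>" and \<alpha>: "0 < \<alpha>" and "\<And>\<zeta>. f \<zeta> \<le> 1"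
  shows "abel_mean p \<mu> \<alpha> f \<le> 1"
proof -
  have "abel_mean p \<mu> \<alpha> f \<le> ennreal \<alpha> * (\<integral>\<^sup>+ \<eta>. ennreal (pmf \<mu> \<eta>) * ennreal (1 / \<alpha>) \<partial>count_space \<X>)"
    unfolding abel_mean_def
    by (intro mult_left_mono nn_integral_mono) (use resolvent_le[OF assms(1,3,4)] in auto)
  also have "\<dots> = ennreal \<alpha> * ennreal (1 / \<alpha>)"
    by (simp add: nn_integral_multc pmf_blocking_mass[OF assms(2)])
  also have "\<dots> = 1" using \<alpha> by (simp add: ennreal_mult[symmetric])
  finally show ?thesis .
qed

text \<open>An invariant law is also the law at a random time independent of the process.\<close>

lemma abel_mean_invariant:
  assumes inv: "blocking_invariant_measure p \<mu>" and \<alpha>: "0 < \<alpha>"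
  shows "abel_mean p \<mu> \<alpha> f = (\<integral>\<^sup>+ \<eta>. f \<eta> \<partial>measure_pmf \<mu>)"
proof -
  have supp: "set_pmf \<mu> \<subseteq> \<X>"
    using inv by (auto simp: blocking_invariant_measure_def blocking_measure_def)
  have "abel_mean p \<mu> \<alpha> (indicator {\<xi>}) = ennreal (pmf \<mu> \<xi>)" for \<xi>
  proof -
    let ?S = "jump_semigroup p (indicator {\<xi>})"
    have S: "(\<integral>\<^sup>+ \<eta>. ennreal (pmf \<mu> \<eta>) * ?S t \<eta> \<partial>count_space \<X>) = ennreal (pmf \<mu> \<xi>)" if "0 \<le> t" for t
      using inv that nn_integral_pmf_blocking[OF supp]
      by (simp add: blocking_invariant_measure_def trans_prob_eq)
    have "(\<integral>\<^sup>+ \<eta>. ennreal (pmf \<mu> \<eta>) * resolvent p \<alpha> (indicator {\<xi>}) \<eta> \<partial>count_space \<X>) =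
        (\<integral>\<^sup>+ \<eta>. \<integral>\<^sup>+ t. ennreal (exp (- \<alpha> * t)) * indicator {0..} t * (ennreal (pmf \<mu> \<eta>) * ?S t \<eta>)
          \<partial>lborel \<partial>count_space \<X>)"
      unfolding resolvent_def by (simp add: nn_integral_cmult[symmetric] mult_ac)
    also have "\<dots> = (\<integral>\<^sup>+ t. \<integral>\<^sup>+ \<eta>. ennreal (exp (- \<alpha> * t)) * indicator {0..} t * (ennreal (pmf \<mu> \<eta>) * ?S t \<eta>)
          \<partial>count_space \<X> \<partial>lborel)"
      by (rule nn_integral_count_space_nn_integral[symmetric]) (auto simp: countable_blocking_configs)
    also have "\<dots> = (\<integral>\<^sup>+ t. ennreal (exp (- \<alpha> * t)) * indicator {0..} t * ennreal (pmf \<mu> \<xi>) \<partial>lborel)"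
      by (intro nn_integral_cong) (auto simp: nn_integral_cmult S indicator_def)
    also have "\<dots> = ennreal (1 / \<alpha>) * ennreal (pmf \<mu> \<xi>)"
      using nn_integral_exp[OF \<alpha>] by (simp add: nn_integral_multc)
    finally show ?thesis
      using \<alpha> by (simp add: abel_mean_def mult.assoc[symmetric] ennreal_mult[symmetric])
  qed
  then show ?thesis
    unfolding abel_mean_eq_nn_integral[of p \<mu> \<alpha> f] nn_integral_pmf_blocking[OF supp]
    by (simp add: mult.commute)
qed

text \<open>Both processes start from the same configuration, which is comparable with itself.\<close>

lemma abel_mean_dominated:
  assumes "exclusion_rates p" "exclusion_rates pbar" "dominates pbar p" "0 < \<alpha>" "\<And>\<zeta>. f \<zeta> \<le> 1"
    and "\<And>\<zeta> \<zeta>'. \<zeta> \<prec> \<zeta>' \<Longrightarrow> f \<zeta>' \<le> f \<zeta>"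
  shows "abel_mean pbar \<mu> \<alpha> f \<le> abel_mean p \<mu> \<alpha> f"
  unfolding abel_mean_def
  by (intro mult_left_mono nn_integral_mono) (auto intro!: resolvent_dominated[OF assms] config_prec_refl)

text \<open>The Markov property at time \<open>h\<close>.\<close>

lemma resolvent_split:
  assumes h: "0 \<le> h"
  shows "resolvent p \<alpha> f \<eta> = (\<integral>\<^sup>+ t\<in>{0..h}. ennreal (exp (- \<alpha> * t)) * jump_semigroup p f t \<eta> \<partial>lborel) +
    ennreal (exp (- \<alpha> * h)) * resolvent p \<alpha> (jump_semigroup p f h) \<eta>"
proof -
  let ?F = "\<lambda>t. ennreal (exp (- \<alpha> * t)) * jump_semigroup p f t \<eta>"
  have "resolvent p \<alpha> f \<eta> = (\<integral>\<^sup>+ t. ?F t * indicator {0..h} t + ?F t * indicator {h..} t \<partial>lborel)"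
    unfolding resolvent_def
    by (rule nn_integral_cong_AE, use AE_lborel_singleton[of h] in eventually_elim)
      (use h in \<open>auto simp: indicator_def\<close>)
  also have "\<dots> = (\<integral>\<^sup>+ t\<in>{0..h}. ?F t \<partial>lborel) + (\<integral>\<^sup>+ t\<in>{h..}. ?F t \<partial>lborel)"
    by (rule nn_integral_add) auto
  also have "(\<integral>\<^sup>+ t\<in>{h..}. ?F t \<partial>lborel) = (\<integral>\<^sup>+ t. ?F (h + t) * indicator {h..} (h + t) \<partial>lborel)"
    using nn_integral_real_affine[of "\<lambda>t. ?F t * indicator {h..} t" 1 h] by simp
  also have "\<dots> = (\<integral>\<^sup>+ t. ennreal (exp (- \<alpha> * h)) *
      (ennreal (exp (- \<alpha> * t)) * jump_semigroup p (jump_semigroup p f h) t \<eta> * indicator {0..} t) \<partial>lborel)"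
  proof (rule nn_integral_cong)
    fix t
    have "ennreal (exp (- \<alpha> * (h + t))) = ennreal (exp (- \<alpha> * h)) * ennreal (exp (- \<alpha> * t))"
      by (rule ennreal_exp_add) (simp add: algebra_simps)
    then show "?F (h + t) * indicator {h..} (h + t) = ennreal (exp (- \<alpha> * h)) *
      (ennreal (exp (- \<alpha> * t)) * jump_semigroup p (jump_semigroup p f h) t \<eta> * indicator {0..} t)"
      using jump_semigroup_add[of t h p f \<eta>] h by (auto simp: indicator_def mult.assoc add.commute)
  qed
  also have "\<dots> = ennreal (exp (- \<alpha> * h)) * resolvent p \<alpha> (jump_semigroup p f h) \<eta>"
    unfolding resolvent_def by (rule nn_integral_cmult) auto
  finally show ?thesis .
qed

lemma abel_mean_cmult_resolvent:
  "(\<integral>\<^sup>+ \<eta>. ennreal (pmf \<mu> \<eta>) * (c * resolvent p \<alpha> f \<eta>) \<partial>count_space \<X>) =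
    c * (\<integral>\<^sup>+ \<eta>. ennreal (pmf \<mu> \<eta>) * resolvent p \<alpha> f \<eta> \<partial>count_space \<X>)"
  by (subst nn_integral_cmult[symmetric]) (auto simp: mult_ac)

text \<open>The left side is an expectation at the exponential time shifted by \<open>h\<close>. The density of the shifted
time is \<open>exp (\<alpha> * h)\<close> times the density of the unshifted one after \<open>h\<close>, and zero before.\<close>

lemma abel_mean_semigroup_le:
  assumes h: "0 \<le> h"
  shows "abel_mean p \<mu> \<alpha> (jump_semigroup p f h) \<le> ennreal (exp (\<alpha> * h)) * abel_mean p \<mu> \<alpha> f"
proof -
  have "resolvent p \<alpha> (jump_semigroup p f h) \<eta> \<le> ennreal (exp (\<alpha> * h)) * resolvent p \<alpha> f \<eta>" for \<eta>
  proof -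
    have "resolvent p \<alpha> (jump_semigroup p f h) \<eta> = ennreal (exp (\<alpha> * h)) * (ennreal (exp (- \<alpha> * h)) *
        resolvent p \<alpha> (jump_semigroup p f h) \<eta>)"
      using ennreal_exp_add[of 0 "\<alpha> * h" "- \<alpha> * h"] by (simp add: mult.assoc[symmetric])
    also have "\<dots> \<le> ennreal (exp (\<alpha> * h)) * resolvent p \<alpha> f \<eta>"
      unfolding resolvent_split[OF h, of p \<alpha> f] by (intro mult_left_mono) auto
    finally show ?thesis .
  qed
  then have "abel_mean p \<mu> \<alpha> (jump_semigroup p f h) \<le> ennreal \<alpha> *
      (\<integral>\<^sup>+ \<eta>. ennreal (pmf \<mu> \<eta>) * (ennreal (exp (\<alpha> * h)) * resolvent p \<alpha> f \<eta>) \<partial>count_space \<X>)"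
    unfolding abel_mean_def by (intro mult_left_mono nn_integral_mono) auto
  also have "\<dots> = ennreal (exp (\<alpha> * h)) * abel_mean p \<mu> \<alpha> f"
    unfolding abel_mean_cmult_resolvent abel_mean_def by (simp add: mult_ac)
  finally show ?thesis .
qed

text \<open>With the indicator of \<open>\<X>\<close> as \<open>f\<close>: if no mass has been lost at the exponential time, then none is lost
during a further time \<open>h\<close>. The part of the integral before \<open>h\<close> is at most \<open>1 - exp (- \<alpha> * h)\<close>, which
leaves \<open>exp (- \<alpha> * h)\<close> for the part after \<open>h\<close>.\<close>

lemma abel_mean_semigroup_mass:
  assumes p: "exclusion_rates p" and supp: "set_pmf \<mu> \<subseteq> \<X>" and \<alpha>: "0 < \<alpha>" and h: "0 \<le> h"
    and f: "\<And>\<zeta>. f \<zeta> \<le> 1" and mass: "abel_mean p \<mu> \<alpha> f = 1"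
  shows "1 \<le> abel_mean p \<mu> \<alpha> (jump_semigroup p f h)"
proof -
  let ?c = "exp (- \<alpha> * h)"
  have int: "(\<integral>\<^sup>+ t\<in>{0..h}. ennreal (exp (- \<alpha> * t)) * jump_semigroup p f t \<eta> \<partial>lborel) \<le> ennreal ((1 - ?c) / \<alpha>)"
    if "\<eta> \<in> \<X>" for \<eta>
  proof -
    have "(\<integral>\<^sup>+ t\<in>{0..h}. ennreal (exp (- \<alpha> * t)) * jump_semigroup p f t \<eta> \<partial>lborel) \<le>
        (\<integral>\<^sup>+ t. ennreal (exp (- \<alpha> * t)) * indicator {0..h} t \<partial>lborel)"
    proof (rule nn_integral_mono)
      fix t
      show "ennreal (exp (- \<alpha> * t)) * jump_semigroup p f t \<eta> * indicator {0..h} t \<le>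
          ennreal (exp (- \<alpha> * t)) * indicator {0..h} t"
        using mult_left_mono[OF jump_semigroup_le_1[OF p f that, of t], of "ennreal (exp (- \<alpha> * t))"]
        by (auto simp: indicator_def)
    qed
    also have "\<dots> = ennreal (- exp (- \<alpha> * h) / \<alpha> - - exp (- \<alpha> * 0) / \<alpha>)"
      by (rule nn_integral_FTC_Icc) (use \<alpha> h in \<open>auto intro!: derivative_eq_intros\<close>)
    also have "\<dots> = ennreal ((1 - ?c) / \<alpha>)" by (simp add: diff_divide_distrib)
    finally show ?thesis .
  qed
  have "1 = abel_mean p \<mu> \<alpha> f" using mass by simp
  also have "\<dots> \<le> ennreal \<alpha> * (\<integral>\<^sup>+ \<eta>. ennreal (pmf \<mu> \<eta>) * ennreal ((1 - ?c) / \<alpha>) +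
      ennreal (pmf \<mu> \<eta>) * (ennreal ?c * resolvent p \<alpha> (jump_semigroup p f h) \<eta>) \<partial>count_space \<X>)"
    unfolding abel_mean_def resolvent_split[OF h, of p \<alpha> f]
  proof (intro mult_left_mono nn_integral_mono)
    fix \<eta>
    assume "\<eta> \<in> space (count_space \<X>)"
    then have "\<eta> \<in> \<X>" by simp
    from int[OF this] show "ennreal (pmf \<mu> \<eta>) *
        ((\<integral>\<^sup>+ t\<in>{0..h}. ennreal (exp (- \<alpha> * t)) * jump_semigroup p f t \<eta> \<partial>lborel) +
          ennreal ?c * resolvent p \<alpha> (jump_semigroup p f h) \<eta>) \<le>
        ennreal (pmf \<mu> \<eta>) * ennreal ((1 - ?c) / \<alpha>) +
        ennreal (pmf \<mu> \<eta>) * (ennreal ?c * resolvent p \<alpha> (jump_semigroup p f h) \<eta>)"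
      by (subst distrib_left[symmetric]) (intro mult_left_mono add_right_mono, auto)
  qed simp
  also have "\<dots> = ennreal \<alpha> * ennreal ((1 - ?c) / \<alpha>) + ennreal ?c * abel_mean p \<mu> \<alpha> (jump_semigroup p f h)"
    by (subst nn_integral_add)
      (auto simp: nn_integral_multc pmf_blocking_mass[OF supp] abel_mean_cmult_resolvent abel_mean_def
        distrib_left mult_ac)
  also have "ennreal \<alpha> * ennreal ((1 - ?c) / \<alpha>) = ennreal (1 - ?c)"
    using \<alpha> h by (simp add: ennreal_mult[symmetric])
  finally have le: "1 \<le> ennreal (1 - ?c) + ennreal ?c * abel_mean p \<mu> \<alpha> (jump_semigroup p f h)" .
  have "abel_mean p \<mu> \<alpha> (jump_semigroup p f h) \<le> ennreal (exp (\<alpha> * h))"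
    using abel_mean_semigroup_le[OF h, of p \<mu> \<alpha> f] mass by simp
  then obtain m where m: "abel_mean p \<mu> \<alpha> (jump_semigroup p f h) = ennreal m" "0 \<le> m"
    by (metis ennreal_cases ennreal_less_top leD top_greatest)
  have c: "?c \<le> 1" using \<alpha> h by simp
  have "ennreal 1 \<le> ennreal (1 - ?c + ?c * m)"
    using le m c by (simp add: ennreal_mult[symmetric] ennreal_plus[symmetric] del: ennreal_plus)
  then have "1 \<le> 1 - ?c + ?c * m" using m c by (subst (asm) ennreal_le_iff) auto
  then have "?c * 1 \<le> ?c * m" by simp
  then have "1 \<le> m" by (subst (asm) mult_le_cancel_left_pos) auto
  then show ?thesis using m by (metis ennreal_1 ennreal_leI)
qed

text \<open>The indicator of \<open>\<X>\<close> is decreasing, so the dominated process explodes no sooner than the stationary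
one, which does not explode.\<close>

lemma abel_mean_mass:
  assumes "exclusion_rates p" "exclusion_rates pbar" "dominates pbar p"
    and inv: "blocking_invariant_measure pbar \<mu>" and \<alpha>: "0 < \<alpha>"
  shows "abel_mean p \<mu> \<alpha> (indicator \<X>) = 1"
proof (rule antisym)
  have supp: "set_pmf \<mu> \<subseteq> \<X>"
    using inv by (auto simp: blocking_invariant_measure_def blocking_measure_def)
  show "abel_mean p \<mu> \<alpha> (indicator \<X>) \<le> 1"
    by (rule abel_mean_le_1[OF assms(1) supp \<alpha>]) (simp add: indicator_def)
  have "1 = (\<integral>\<^sup>+ \<eta>. indicator \<X> \<eta> \<partial>measure_pmf \<mu>)"
    using nn_integral_pmf_blocking[OF supp, of "indicator \<X>"] pmf_blocking_mass[OF supp]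
    by (simp cong: nn_integral_cong_simp)
  also have "\<dots> = abel_mean pbar \<mu> \<alpha> (indicator \<X>)"
    by (rule abel_mean_invariant[OF inv \<alpha>, symmetric])
  also have "\<dots> \<le> abel_mean p \<mu> \<alpha> (indicator \<X>)"
    by (rule abel_mean_dominated[OF assms(1-3) \<alpha>]) (auto simp: indicator_def config_prec_def)
  finally show "1 \<le> abel_mean p \<mu> \<alpha> (indicator \<X>)" .
qed

lemma jump_semigroup_indicator_outside:
  assumes "\<eta> \<in> \<X>" "\<zeta> \<notin> \<X>"
  shows "jump_semigroup p (indicator {\<zeta>}) t \<eta> = 0"
proof -
  have "jump_semigroup p (indicator {\<zeta>}) t \<eta> = (\<integral>\<^sup>+ \<xi>. 0 \<partial>count_space \<X>)"
    unfolding jump_semigroup_eq_nn_integral[OF assms(1), of p "indicator {\<zeta>}"]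
    by (intro nn_integral_cong) (use assms(2) in \<open>auto simp: indicator_def\<close>)
  then show ?thesis by simp
qed

section \<open>A limit of the Abel means\<close>

lemma nn_integral_count_space_antisym:
  fixes f g :: "'a \<Rightarrow> ennreal"
  assumes le: "\<And>x. x \<in> A \<Longrightarrow> f x \<le> g x"
    and int: "(\<integral>\<^sup>+ x. g x \<partial>count_space A) \<le> (\<integral>\<^sup>+ x. f x \<partial>count_space A)"
    and fin: "(\<integral>\<^sup>+ x. f x \<partial>count_space A) < \<infinity>" and x: "x \<in> A"
  shows "f x = g x"
proof -
  have "(\<integral>\<^sup>+ x. g x - f x \<partial>count_space A) = (\<integral>\<^sup>+ x. g x \<partial>count_space A) - (\<integral>\<^sup>+ x. f x \<partial>count_space A)"
    by (rule nn_integral_diff) (use le fin in \<open>auto simp: AE_count_space\<close>)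
  also have "\<dots> = 0" using int fin by (intro diff_eq_0_ennreal) auto
  finally have "g x - f x = 0"
    using nn_integral_ge_point[OF x, of "\<lambda>x. g x - f x"] by simp
  then have "g x \<le> f x" using ennreal_minus_eq_0 by blast
  then show ?thesis using le[OF x] by simp
qed

lemma diagonal_subsequence:
  fixes m :: "nat \<Rightarrow> 'a \<Rightarrow> ennreal"
  assumes "countable A"
  obtains r l where "strict_mono (r :: nat \<Rightarrow> nat)" "\<And>x. x \<in> A \<Longrightarrow> (\<lambda>k. m (r k) x) \<longlonglongrightarrow> l x"
proof -
  define P where "P n s \<longleftrightarrow> convergent (\<lambda>k. m (s k) (from_nat_into A n))" for n and s :: "nat \<Rightarrow> nat"
  interpret subseqs P
  proof
    fix n and s :: "nat \<Rightarrow> nat"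
    obtain l r where "strict_mono r" "((\<lambda>k. m (s k) (from_nat_into A n)) \<circ> r) \<longlonglongrightarrow> l"
      using compact_complete_linorder by blast
    then show "\<exists>r'. strict_mono r' \<and> P n (s \<circ> r')"
      by (auto simp: P_def o_def convergent_def)
  qed
  have "convergent (\<lambda>k. m (diagseq k) x)" if x: "x \<in> A" for x
  proof -
    let ?n = "to_nat_on A x"
    have "P ?n (diagseq \<circ> (+) (Suc ?n))"
    proof (rule diagseq_holds)
      fix r s :: "nat \<Rightarrow> nat" and n
      assume "strict_mono r" "P n s"
      then show "P n (s \<circ> r)"
        using LIMSEQ_subseq_LIMSEQ[of "\<lambda>k. m (s k) (from_nat_into A n)" _ r]
        by (auto simp: P_def convergent_def o_def)
    qed
    then have "convergent (\<lambda>k. m (diagseq (k + Suc ?n)) x)"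
      using x assms by (simp add: P_def o_def add.commute)
    then show ?thesis
      using LIMSEQ_offset[of "\<lambda>k. m (diagseq k) x" "Suc ?n"] unfolding convergent_def by blast
  qed
  then have "\<And>x. x \<in> A \<Longrightarrow> (\<lambda>k. m (diagseq k) x) \<longlonglongrightarrow> lim (\<lambda>k. m (diagseq k) x)"
    by (simp add: convergent_LIMSEQ_iff)
  then show ?thesis by (rule that[OF subseq_diagseq])
qed

lemma nn_integral_count_space_Fatou:
  fixes m :: "nat \<Rightarrow> 'a \<Rightarrow> ennreal"
  assumes lim: "\<And>x. x \<in> A \<Longrightarrow> (\<lambda>k. m k x) \<longlonglongrightarrow> l x"
    and fin: "\<And>x. x \<in> A \<Longrightarrow> l x < \<top>" "\<And>x. x \<in> A \<Longrightarrow> f x < \<top>"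
    and le: "\<And>k. (\<integral>\<^sup>+ x. m k x * f x \<partial>count_space A) \<le> u k" and u: "u \<longlonglongrightarrow> c"
  shows "(\<integral>\<^sup>+ x. l x * f x \<partial>count_space A) \<le> c"
proof -
  have "(\<integral>\<^sup>+ x. l x * f x \<partial>count_space A) = (\<integral>\<^sup>+ x. liminf (\<lambda>k. m k x * f x) \<partial>count_space A)"
  proof (rule nn_integral_cong)
    fix x
    assume "x \<in> space (count_space A)"
    then have "(\<lambda>k. m k x * f x) \<longlonglongrightarrow> l x * f x"
      using lim fin[of x] by (intro tendsto_mult_ennreal tendsto_const) auto
    then show "l x * f x = liminf (\<lambda>k. m k x * f x)"
      by (simp add: lim_imp_Liminf)
  qed
  also have "\<dots> \<le> liminf (\<lambda>k. \<integral>\<^sup>+ x. m k x * f x \<partial>count_space A)"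
    by (rule nn_integral_liminf) simp
  also have "\<dots> \<le> liminf u"
    by (intro Liminf_mono always_eventually allI le)
  also have "\<dots> = c" using u by (simp add: lim_imp_Liminf)
  finally show ?thesis .
qed

lemma one_le_of_emeasure_pmf_finite_le:
  assumes "\<And>K. finite K \<Longrightarrow> K \<subseteq> set_pmf \<mu> \<Longrightarrow> emeasure (measure_pmf \<mu>) K \<le> c"
  shows "1 \<le> c"
proof -
  define K where "K n = from_nat_into (set_pmf \<mu>) ` {..n}" for n :: nat
  have K_union: "(\<Union>n. K n) = set_pmf \<mu>"
    using range_from_nat_into[OF set_pmf_not_empty countable_set_pmf, of \<mu>]
    by (simp add: K_def image_UN[symmetric] UN_atMost_UNIV)
  have "1 = emeasure (measure_pmf \<mu>) (\<Union>n. K n)"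
    unfolding K_union by (rule measure_pmf.emeasure_eq_1_AE[symmetric]) (auto simp: AE_measure_pmf)
  also have "\<dots> = (SUP n. emeasure (measure_pmf \<mu>) (K n))"
    by (rule SUP_emeasure_incseq[symmetric]) (auto simp: incseq_def K_def)
  also have "\<dots> \<le> c"
  proof (rule SUP_least)
    fix n
    have "K n \<subseteq> set_pmf \<mu>" using K_union by blast
    then show "emeasure (measure_pmf \<mu>) (K n) \<le> c"
      by (intro assms) (simp add: K_def)
  qed
  finally show ?thesis .
qed

lemma ex_pmf_of_weights:
  fixes l :: "'a \<Rightarrow> ennreal"
  assumes mass: "(\<integral>\<^sup>+ x. l x \<partial>count_space A) = 1"
  shows "\<exists>\<nu>. set_pmf \<nu> \<subseteq> A \<and> (\<forall>x\<in>A. ennreal (pmf \<nu> x) = l x)"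
proof -
  define w where "w x = (if x \<in> A then enn2real (l x) else 0)" for x
  have w: "ennreal (w x) = l x" if "x \<in> A" for x
  proof -
    have "l x \<le> 1" using nn_integral_ge_point[OF that, of l] mass by simp
    then have "l x < \<top>" by (simp add: le_less_trans)
    then show ?thesis using that by (simp add: w_def)
  qed
  have nonneg: "0 \<le> w x" for x by (simp add: w_def)
  have "(\<integral>\<^sup>+ x. ennreal (w x) \<partial>count_space UNIV) = (\<integral>\<^sup>+ x. ennreal (w x) * indicator A x \<partial>count_space UNIV)"
    by (intro nn_integral_cong) (simp add: w_def indicator_def)
  also have "\<dots> = (\<integral>\<^sup>+ x. ennreal (w x) \<partial>count_space A)"
    by (rule nn_integral_count_space_indicator[symmetric]) simp
  also have "\<dots> = 1" using mass by (simp add: w cong: nn_integral_cong_simp)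
  finally have "pmf (embed_pmf w) = w"
    by (intro ext pmf_embed_pmf nonneg)
  then show ?thesis
    by (intro exI[of _ "embed_pmf w"]) (auto simp: set_pmf_iff w, simp add: w_def split: if_splits)
qed

text \<open>The pointwise limit \<open>l\<close> of the Abel means is a probability measure because the Abel means give each
finite downwards closed set \<open>D\<close> at least the mass \<open>\<mu>(D)\<close>, and such sets exhaust \<open>\<X>\<close>. Invariance follows
from \<open>l P\<^sub>h \<le> l\<close> together with conservation of mass: the Abel means charge only states from
which the process does not explode, and so does their limit.\<close>

theorem invariant_measure_of_dominated:
  assumes p: "exclusion_rates p" and pbar: "exclusion_rates pbar" and dom: "dominates pbar p"
    and inv: "blocking_invariant_measure pbar \<mu>"
  shows "\<exists>\<nu>. blocking_invariant_measure p \<nu>"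
proof -
  have supp: "set_pmf \<mu> \<subseteq> \<X>"
    using inv by (auto simp: blocking_invariant_measure_def blocking_measure_def)
  define a where "a k = 1 / real (Suc k)" for k
  have a: "0 < a k" for k by (simp add: a_def)
  define m where "m k \<xi> = abel_mean p \<mu> (a k) (indicator {\<xi>})" for k \<xi>
  have mean: "abel_mean p \<mu> (a k) f = (\<integral>\<^sup>+ \<xi>. m k \<xi> * f \<xi> \<partial>count_space \<X>)" for k f
    unfolding abel_mean_eq_nn_integral[of p \<mu> _ f] m_def by (simp add: mult.commute)
  have mass: "(\<integral>\<^sup>+ \<xi>. m k \<xi> \<partial>count_space \<X>) = 1" for k
    using abel_mean_mass[OF p pbar dom inv a] unfolding mean by (simp cong: nn_integral_cong_simp)
  obtain r l where r: "strict_mono (r :: nat \<Rightarrow> nat)"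
    and l: "\<And>\<xi>. \<xi> \<in> \<X> \<Longrightarrow> (\<lambda>k. m (r k) \<xi>) \<longlonglongrightarrow> l \<xi>"
    using diagonal_subsequence[OF countable_blocking_configs, of m] by blast
  have l_fin: "l \<xi> < \<top>" if "\<xi> \<in> \<X>" for \<xi>
  proof -
    have "l \<xi> \<le> 1"
      using nn_integral_ge_point[OF that, of "m (r k)" for k]
      by (intro LIMSEQ_le_const2[OF l[OF that]]) (simp add: mass)
    then show ?thesis by (simp add: le_less_trans)
  qed
  have mass_l: "(\<integral>\<^sup>+ \<xi>. l \<xi> \<partial>count_space \<X>) = 1"
  proof (rule antisym)
    show "(\<integral>\<^sup>+ \<xi>. l \<xi> \<partial>count_space \<X>) \<le> 1"
      using nn_integral_count_space_Fatou[of \<X> "\<lambda>k. m (r k)" l "\<lambda>_. 1" "\<lambda>_. 1" 1] l l_fin mass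
      by simp
    have "emeasure (measure_pmf \<mu>) K \<le> (\<integral>\<^sup>+ \<xi>. l \<xi> \<partial>count_space \<X>)"
      if K: "finite K" "K \<subseteq> set_pmf \<mu>" for K
    proof -
      \<comment> \<open>the closure of \<open>K\<close> downwards, still finite, to which the comparison applies\<close>
      define D where "D = (\<Union>\<kappa>\<in>K. {\<eta>. \<eta> \<prec> \<kappa>})"
      have "finite D" using K(1) finite_config_prec_below by (simp add: D_def)
      moreover have "D \<subseteq> \<X>" by (auto simp: D_def config_prec_def)
      moreover have "K \<subseteq> D" using K supp config_prec_refl by (auto simp: D_def)
      ultimately have D: "finite D" "D \<subseteq> \<X>" "K \<subseteq> D" .
      have Dsum: "(\<integral>\<^sup>+ \<xi>. g \<xi> * indicator D \<xi> \<partial>count_space \<X>) = (\<Sum>\<xi>\<in>D. g \<xi>)"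
        for g :: "config \<Rightarrow> ennreal"
      proof -
        have "(\<integral>\<^sup>+ \<xi>. g \<xi> * indicator D \<xi> \<partial>count_space \<X>) = (\<Sum>\<xi>\<in>D. g \<xi> * indicator D \<xi>)"
          by (rule nn_integral_count_space'[OF D(1)]) (use D in auto)
        then show ?thesis by simp
      qed
      have "emeasure (measure_pmf \<mu>) K \<le> emeasure (measure_pmf \<mu>) D"
        by (rule emeasure_mono) (use D in auto)
      also have "\<dots> = (\<integral>\<^sup>+ \<eta>. indicator D \<eta> \<partial>measure_pmf \<mu>)" by simp
      finally have K_le: "emeasure (measure_pmf \<mu>) K \<le> (\<integral>\<^sup>+ \<eta>. indicator D \<eta> \<partial>measure_pmf \<mu>)" .
      have "emeasure (measure_pmf \<mu>) K \<le> (\<Sum>\<xi>\<in>D. m k \<xi>)" for k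
      proof -
        note K_le
        also have "(\<integral>\<^sup>+ \<eta>. indicator D \<eta> \<partial>measure_pmf \<mu>) = abel_mean pbar \<mu> (a k) (indicator D)"
          by (rule abel_mean_invariant[OF inv a, symmetric])
        also have "\<dots> \<le> abel_mean p \<mu> (a k) (indicator D)"
          by (rule abel_mean_dominated[OF p pbar dom a])
            (auto simp: indicator_def D_def intro: config_prec_trans)
        also have "\<dots> = (\<Sum>\<xi>\<in>D. m k \<xi>)" unfolding mean Dsum ..
        finally show ?thesis .
      qed
      moreover have "(\<lambda>k. \<Sum>\<xi>\<in>D. m (r k) \<xi>) \<longlonglongrightarrow> (\<Sum>\<xi>\<in>D. l \<xi>)"
        by (intro tendsto_sum l) (use D in auto)
      ultimately have "emeasure (measure_pmf \<mu>) K \<le> (\<Sum>\<xi>\<in>D. l \<xi>)"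
        by (intro LIMSEQ_le_const) auto
      also have "\<dots> = (\<integral>\<^sup>+ \<xi>. l \<xi> * indicator D \<xi> \<partial>count_space \<X>)" by (rule Dsum[symmetric])
      also have "\<dots> \<le> (\<integral>\<^sup>+ \<xi>. l \<xi> \<partial>count_space \<X>)"
        by (intro nn_integral_mono) (auto simp: indicator_def)
      finally show ?thesis .
    qed
    then show "1 \<le> (\<integral>\<^sup>+ \<xi>. l \<xi> \<partial>count_space \<X>)" by (rule one_le_of_emeasure_pmf_finite_le)
  qed
  have inv_l: "(\<integral>\<^sup>+ \<eta>. l \<eta> * jump_semigroup p (indicator {\<zeta>}) h \<eta> \<partial>count_space \<X>) = l \<zeta>"
    if h: "0 \<le> h" and \<zeta>: "\<zeta> \<in> \<X>" for h \<zeta>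
  proof -
    let ?P = "\<lambda>\<zeta>. jump_semigroup p (indicator {\<zeta>}) h" and ?P1 = "jump_semigroup p (indicator \<X>) h"
    have P_le: "jump_semigroup p (indicator A) h \<eta> \<le> 1" if "\<eta> \<in> \<X>" for A \<eta>
      by (rule jump_semigroup_le_1[OF p _ that h]) (simp add: indicator_def)
    have P_fin: "jump_semigroup p (indicator A) h \<eta> < \<top>" if "\<eta> \<in> \<X>" for A \<eta>
      using P_le[OF that, of A] by (simp add: le_less_trans)
    have sub: "(\<integral>\<^sup>+ \<eta>. l \<eta> * ?P \<zeta> \<eta> \<partial>count_space \<X>) \<le> l \<zeta>" if \<zeta>: "\<zeta> \<in> \<X>" for \<zeta>
    proof (rule nn_integral_count_space_Fatou[OF l l_fin P_fin])
      show "(\<integral>\<^sup>+ \<xi>. m (r k) \<xi> * ?P \<zeta> \<xi> \<partial>count_space \<X>) \<le> ennreal (exp (a (r k) * h)) * m (r k) \<zeta>" for k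
        using abel_mean_semigroup_le[OF h, of p \<mu> "a (r k)" "indicator {\<zeta>}"]
        unfolding mean[of _ "?P \<zeta>"] m_def[symmetric] .
      have "(\<lambda>k. a (r k)) \<longlonglongrightarrow> 0"
        using LIMSEQ_subseq_LIMSEQ[OF LIMSEQ_inverse_real_of_nat r]
        by (simp add: a_def o_def inverse_eq_divide)
      then have "(\<lambda>k. exp (a (r k) * h)) \<longlonglongrightarrow> exp (0 * h)"
        by (intro tendsto_intros)
      then have "(\<lambda>k. ennreal (exp (a (r k) * h)) * m (r k) \<zeta>) \<longlonglongrightarrow> ennreal (exp (0 * h)) * l \<zeta>"
        using l_fin[OF \<zeta>] by (intro tendsto_mult_ennreal l \<zeta> tendsto_ennrealI) auto
      then show "(\<lambda>k. ennreal (exp (a (r k) * h)) * m (r k) \<zeta>) \<longlonglongrightarrow> l \<zeta>" by simp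
    qed
    \<comment> \<open>the process does not explode before time \<open>h\<close> from a state charged by an Abel mean\<close>
    have conserve: "m k \<eta> * ?P1 \<eta> = m k \<eta>" if "\<eta> \<in> \<X>" for k \<eta>
    proof (rule nn_integral_count_space_antisym[OF _ _ _ that])
      have le: "m k \<xi> * ?P1 \<xi> \<le> m k \<xi>" if "\<xi> \<in> \<X>" for \<xi>
        using mult_left_mono[OF P_le[OF that, of \<X>], of "m k \<xi>"] by simp
      then show "\<And>\<xi>. \<xi> \<in> \<X> \<Longrightarrow> m k \<xi> * ?P1 \<xi> \<le> m k \<xi>" .
      show "(\<integral>\<^sup>+ \<xi>. m k \<xi> \<partial>count_space \<X>) \<le> (\<integral>\<^sup>+ \<xi>. m k \<xi> * ?P1 \<xi> \<partial>count_space \<X>)"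
        using abel_mean_semigroup_mass[OF p supp a h _ abel_mean_mass[OF p pbar dom inv a], of k]
        unfolding mean mass by (simp add: indicator_def)
      have "(\<integral>\<^sup>+ \<xi>. m k \<xi> * ?P1 \<xi> \<partial>count_space \<X>) \<le> 1"
        unfolding mass[of k, symmetric] by (intro nn_integral_mono le) simp
      then show "(\<integral>\<^sup>+ \<xi>. m k \<xi> * ?P1 \<xi> \<partial>count_space \<X>) < \<infinity>" by (simp add: le_less_trans)
    qed
    have conserve_l: "l \<eta> * ?P1 \<eta> = l \<eta>" if \<eta>: "\<eta> \<in> \<X>" for \<eta>
    proof (rule LIMSEQ_unique)
      have "(\<lambda>k. m (r k) \<eta> * ?P1 \<eta>) \<longlonglongrightarrow> l \<eta> * ?P1 \<eta>"
        using l_fin[OF \<eta>] P_fin[OF \<eta>, of \<X>]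
        by (intro tendsto_mult_ennreal tendsto_const l \<eta>) auto
      then show "(\<lambda>k. m (r k) \<eta>) \<longlonglongrightarrow> l \<eta> * ?P1 \<eta>" by (simp add: conserve[OF \<eta>])
    qed (rule l[OF \<eta>])
    have "(\<integral>\<^sup>+ \<zeta>. \<integral>\<^sup>+ \<eta>. l \<eta> * ?P \<zeta> \<eta> \<partial>count_space \<X> \<partial>count_space \<X>) =
        (\<integral>\<^sup>+ \<eta>. \<integral>\<^sup>+ \<zeta>. l \<eta> * ?P \<zeta> \<eta> \<partial>count_space \<X> \<partial>count_space \<X>)"
      by (rule nn_integral_count_space_swap[OF countable_blocking_configs])
    also have "\<dots> = (\<integral>\<^sup>+ \<eta>. l \<eta> * ?P1 \<eta> \<partial>count_space \<X>)"
      by (intro nn_integral_cong)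
        (simp add: nn_integral_cmult jump_semigroup_eq_nn_integral[of _ p "indicator \<X>"] cong: nn_integral_cong_simp)
    also have "\<dots> = 1" using mass_l by (simp add: conserve_l cong: nn_integral_cong_simp)
    finally have total: "(\<integral>\<^sup>+ \<zeta>. \<integral>\<^sup>+ \<eta>. l \<eta> * ?P \<zeta> \<eta> \<partial>count_space \<X> \<partial>count_space \<X>) = 1" .
    show ?thesis
      by (rule nn_integral_count_space_antisym[OF sub _ _ \<zeta>]) (simp_all add: total mass_l)
  qed
  obtain \<nu> where supp_\<nu>: "set_pmf \<nu> \<subseteq> \<X>" and \<nu>: "\<And>\<eta>. \<eta> \<in> \<X> \<Longrightarrow> ennreal (pmf \<nu> \<eta>) = l \<eta>"
    using ex_pmf_of_weights[OF mass_l] by blast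
  have "(\<integral>\<^sup>+ \<eta>. trans_prob p t \<eta> \<zeta> \<partial>measure_pmf \<nu>) = ennreal (pmf \<nu> \<zeta>)" if t: "0 \<le> t" for t \<zeta>
  proof -
    have "(\<integral>\<^sup>+ \<eta>. trans_prob p t \<eta> \<zeta> \<partial>measure_pmf \<nu>) =
        (\<integral>\<^sup>+ \<eta>. l \<eta> * jump_semigroup p (indicator {\<zeta>}) t \<eta> \<partial>count_space \<X>)"
      unfolding nn_integral_pmf_blocking[OF supp_\<nu>] trans_prob_eq
      by (intro nn_integral_cong) (simp add: \<nu>)
    also have "\<dots> = ennreal (pmf \<nu> \<zeta>)"
    proof (cases "\<zeta> \<in> \<X>")
      case True
      then show ?thesis using inv_l[OF t True] \<nu> by simp
    next
      case False
      then have "pmf \<nu> \<zeta> = 0" using supp_\<nu> by (auto simp: set_pmf_iff)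
      with False show ?thesis by (simp add: jump_semigroup_indicator_outside cong: nn_integral_cong_simp)
    qed
    finally show ?thesis .
  qed
  then have "blocking_invariant_measure p \<nu>"
    using supp_\<nu> by (simp add: blocking_invariant_measure_def blocking_measure_def)
  then show ?thesis by blast
qed

theorem theorem4p1:
  fixes p pbar :: rates
  assumes "exclusion_rates p" and "exclusion_rates pbar"
    and "\<And>\<eta> \<eta>' x y x' y'. \<lbrakk>\<eta> \<prec> \<eta>'; \<eta> x; \<eta>' x'; \<not> \<eta> y; \<not> \<eta>' y'; x' \<le> x; x < y; y \<le> y'\<rbrakk>
           \<Longrightarrow> p x y \<eta> \<ge> pbar x' y' \<eta>'"
    and "\<And>\<eta> \<eta>' x y x' y'. \<lbrakk>\<eta> \<prec> \<eta>'; \<eta> x; \<eta>' x'; \<not> \<eta> y; \<not> \<eta>' y'; y \<le> y'; y' < x'; x' \<le> x\<rbrakk>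
           \<Longrightarrow> p x y \<eta> \<le> pbar x' y' \<eta>'"
    and "\<exists>\<mu>. blocking_invariant_measure pbar \<mu>"
  shows "\<exists>\<mu>. blocking_invariant_measure p \<mu>"
proof -
  have "dominates pbar p" unfolding dominates_def using assms(3,4) by blast
  then show ?thesis using assms(1,2,5) invariant_measure_of_dominated by blast
qed

end
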